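(* Consider the Poisson model $P_\theta=\mathrm{Poi}(\theta)$, $\theta\in\mathbb R_+$. (i) (Compactly supported case.) For any $h>0$, there exist constants $c_0=c_0(h)>0$ and $n_0$ such that for all $n\ge n_0$, $$R_n(\mathcal P([0,h]))\ \ge\ \frac{c_0}{n}\,\frac{\log n}{\log\log n},$$ where $\mathcal P([0,h])$ is the set of all probability distributions supported on $[0,h]$. (ii) (Subexponential case.) For any $s>0$, there exist constants $c_1=c_1(s)>0$ and $n_0$ such that for all $n\ge n_0$, $$R_n(\mathsf{SubE}(s))\ \ge\ \frac{c_1}{n}\log n,$$ where $\mathsf{SubE}(s)=\{G:\ G([t,\infty))\le 2e^{-t/s}\ \ \forall t>0\}$ is the set of $s$-subexponential probability distributions on $\mathbb R_+$.
   Context: For a prior $G$ on $\mathbb R_+$, $f_G(y)=\int e^{-\theta}\frac{\theta^y}{y!}\,G(d\theta)$, $y\in\mathbb Z_+=\{0,1,\dots\}$, is the Poisson mixture probability mass function. The minimax squared Hellinger risk for density estimation over the class $\{f_G:G\in\mathcal G\}$ is $$R_n(\mathcal G)=\inf_{\hat f}\sup_{G\in\mathcal G}\mathbb E_G[H^2(f_G,\hat f)],$$ where $\hat f$ is a density estimate measurable with respect to the i.i.d. sample $Y_1,\dots,Y_n\sim f_G$, and $H(f,g)=\left(\int(\sqrt f-\sqrt g)^2\,d\nu\right)^{1/2}$ is the Hellinger distance between densities with respect to the dominating measure $\nu$ (counting measure on $\mathbb Z_+$ here). *)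

theory Defs
  imports "HOL-Probability.Probability"
begin

(* A prior on the half-line is encoded as a Borel probability measure on the whole real line
   that gives full mass to {0..}; negative arguments therefore never contribute to integrals. *)
definition priors :: "real measure set" where
  "priors = {G. prob_space G \<and> sets G = sets borel \<and> measure G {0..} = 1}"

definition compact_priors :: "real \<Rightarrow> real measure set" where
  "compact_priors h = {G \<in> priors. measure G {0..h} = 1}"

definition SubE :: "real \<Rightarrow> real measure set" where
  "SubE s = {G \<in> priors. \<forall>t>0. measure G {t..} \<le> 2 * exp (- t / s)}"

definition poisson_mixture :: "real measure \<Rightarrow> nat \<Rightarrow> real" where
  "poisson_mixture G y = (\<integral>\<theta>. exp (- \<theta>) * (\<theta> ^ y / fact y) \<partial>G)"

definition prob_density :: "'a measure \<Rightarrow> ('a \<Rightarrow> real) \<Rightarrow> bool" where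
  "prob_density \<nu> f \<longleftrightarrow>
     f \<in> borel_measurable \<nu> \<and> (\<forall>x\<in>space \<nu>. 0 \<le> f x) \<and> (\<integral>\<^sup>+x. ennreal (f x) \<partial>\<nu>) = 1"

(* Only meant for densities f and g, for which the integrand is always integrable. *)
definition hellinger :: "'a measure \<Rightarrow> ('a \<Rightarrow> real) \<Rightarrow> ('a \<Rightarrow> real) \<Rightarrow> real" where
  "hellinger \<nu> f g = sqrt (\<integral>x. (sqrt (f x) - sqrt (g x))\<^sup>2 \<partial>\<nu>)"

definition sample_law :: "nat \<Rightarrow> real measure \<Rightarrow> (nat \<Rightarrow> nat) measure" where
  "sample_law n G =
     (\<Pi>\<^sub>M i\<in>{..<n}. density (count_space UNIV) (\<lambda>y. ennreal (poisson_mixture G y)))"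

(* Non-randomised estimators: a sample (Y 0, ..., Y (n - 1)) is mapped to a probability
   density on the natural numbers. *)
definition density_estimators :: "nat \<Rightarrow> ((nat \<Rightarrow> nat) \<Rightarrow> nat \<Rightarrow> real) set" where
  "density_estimators n =
     {fhat. (\<forall>y. (\<lambda>Y. fhat Y y) \<in> borel_measurable (\<Pi>\<^sub>M i\<in>{..<n}. count_space UNIV)) \<and>
            (\<forall>Y \<in> space (\<Pi>\<^sub>M i\<in>{..<n}. count_space UNIV). prob_density (count_space UNIV) (fhat Y))}"

(* The value is taken in the extended nonnegative reals, a complete lattice, so that the
   infimum and supremum need no boundedness or nonemptiness side conditions. *)
definition minimax_risk :: "nat \<Rightarrow> real measure set \<Rightarrow> ennreal" where
  "minimax_risk n \<G> =
     (INF fhat \<in> density_estimators n. SUP G \<in> \<G>.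
        \<integral>\<^sup>+Y. ennreal ((hellinger (count_space UNIV) (poisson_mixture G) (fhat Y))\<^sup>2)
          \<partial>sample_law n G)"

end

theory Submission
  imports Defs "HOL-Computational_Algebra.Polynomial" "HOL-Real_Asymp.Real_Asymp"
begin

text \<open>A density on the nonnegative integers can be estimated at a point \<open>y\<close> only up to the fluctuations
  of the empirical frequency of \<open>y\<close>. In squared Hellinger loss these cost about \<open>1 / n\<close> at every \<open>y\<close>, as
  long as \<open>f y\<close> is at least of order \<open>1 / n\<close>. A minimax lower bound of order \<open>m / n\<close> follows if the
  values of a mixture at \<open>1, \<dots>, m\<close> can be perturbed independently of each other without leaving the
  class. For mixtures over \<open>[0, h]\<close> the density decays like \<open>h ^ y / y!\<close>, which permits \<open>m\<close> of order
  \<open>ln n / ln (ln n)\<close>; for subexponential priors the decay is geometric, which permits \<open>m\<close> of order \<open>ln n\<close>.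

  The perturbations come from signed priors on an equispaced grid \<open>0, a, \<dots>, a M\<close> with \<open>M = 4 m\<close>. The
  Poisson mixture of masses \<open>exp (a k) q k\<close> at \<open>a k\<close> has at \<open>y\<close> the value \<open>\<Sum> q k (a k) ^ y / y!\<close>, a power
  moment. Lagrange interpolation therefore gives, for each \<open>i\<close>, masses whose mixture is \<open>1\<close> at \<open>i\<close> and
  \<open>0\<close> at all other points of \<open>1, \<dots>, M\<close> (\<open>dual_weight_moments\<close>), and these masses are at most
  \<open>(1 / a) ^ i\<close> times an exponential in \<open>M\<close> (\<open>abs_dual_weight_le\<close>). A mass at \<open>0\<close> makes the total mass
  zero and is felt only at \<open>y = 0\<close>, where the mixture is bounded below. Beyond \<open>M\<close> the perturbations are
  not controlled individually, but there the mixture of any prior on the grid is so light that they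
  contribute nothing of importance (\<open>f0_tail\<close>).

  The resulting perturbed priors form a hypercube on which neighbouring mixtures are at squared
  Hellinger distance at most \<open>1 / (2 n)\<close> (\<open>neighbours_close\<close>), while coordinate \<open>i\<close> moves the square root
  of the density at \<open>i\<close> by a constant multiple of \<open>1 / sqrt n\<close> (\<open>neighbours_separated\<close>). Assouad's lemma
  (\<open>assouad\<close>) then yields the bound \<open>m / n\<close> up to a constant. Both classes are served by the same
  construction (\<open>minimax_risk_ge_grid\<close>); the only difference is that \<open>a\<close> is of order \<open>1 / m\<close> for compact
  support and constant for subexponential priors. Positivity of the perturbed priors requires
  \<open>(C / a) ^ m \<le> sqrt n\<close> for an absolute constant \<open>C\<close>, and this determines \<open>m\<close>.\<close>

section \<open>Assouad's lemma for Hellinger loss\<close>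
abbreviation samples :: "nat \<Rightarrow> (nat \<Rightarrow> nat) set" where
  "samples n \<equiv> {..<n} \<rightarrow>\<^sub>E UNIV"

definition likelihood :: "nat \<Rightarrow> (nat \<Rightarrow> real) \<Rightarrow> (nat \<Rightarrow> nat) \<Rightarrow> real" where
  "likelihood n f Y = (\<Prod>i<n. f (Y i))"

lemma likelihood_nonneg: "(\<And>y. 0 \<le> f y) \<Longrightarrow> 0 \<le> likelihood n f Y"
  by (simp add: likelihood_def prod_nonneg)

lemma PiM_count_space_nat:
  "(\<Pi>\<^sub>M i\<in>{..<n}. count_space (UNIV :: nat set)) = count_space (samples n)"
  by (rule count_space_PiM_finite) auto

lemma nn_integral_likelihood:
  assumes nonneg: "\<And>y. 0 \<le> f y" and sums: "f sums s"
  shows "(\<integral>\<^sup>+Y. ennreal (likelihood n f Y) \<partial>count_space (samples n)) = ennreal (s ^ n)"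
proof -
  interpret product_sigma_finite "\<lambda>_::nat. count_space (UNIV :: nat set)"
    by unfold_locales (rule sigma_finite_measure.sigma_finite_countable[OF sigma_finite_measure_count_space])
  have s: "0 \<le> s"
    using nonneg sums by (metis sums_unique suminf_nonneg sums_summable)
  have one: "(\<integral>\<^sup>+y. ennreal (f y) \<partial>count_space UNIV) = ennreal s"
    using nonneg sums by (simp add: nn_integral_count_space_nat suminf_ennreal2 sums_summable[OF sums] sums_unique[OF sums, symmetric])
  have "(\<integral>\<^sup>+Y. ennreal (likelihood n f Y) \<partial>count_space (samples n))
      = (\<integral>\<^sup>+Y. (\<Prod>i\<in>{..<n}. ennreal (f (Y i))) \<partial>(\<Pi>\<^sub>M i\<in>{..<n}. count_space (UNIV :: nat set)))"
    by (simp add: PiM_count_space_nat likelihood_def prod_ennreal nonneg)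
  also have "\<dots> = (\<Prod>i<n. ennreal s)"
    by (subst product_nn_integral_prod) (auto simp: one)
  finally show ?thesis
    by (simp add: ennreal_power s)
qed

text \<open>The sample space is countable, so a sample law is a counting density. Besides making the
  likelihood explicit, this makes every function of the sample measurable, in particular the loss
  of an arbitrary estimator.\<close>
lemma sample_law_eq_density:
  assumes nonneg: "\<And>y. 0 \<le> poisson_mixture G y" and sums: "poisson_mixture G sums 1"
  shows "sample_law n G =
    density (count_space (samples n)) (\<lambda>Y. ennreal (likelihood n (poisson_mixture G) Y))"
proof -
  define f where "f = poisson_mixture G"
  have nn: "0 \<le> f y" for y using nonneg by (simp add: f_def)
  interpret C: product_sigma_finite "\<lambda>_::nat. count_space (UNIV :: nat set)"
    by unfold_locales (rule sigma_finite_measure.sigma_finite_countable[OF sigma_finite_measure_count_space])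
  have "prob_space (density (count_space UNIV) (\<lambda>y. ennreal (f y)))"
    using nonneg sums
    by (intro prob_spaceI)
      (simp add: emeasure_density nn_integral_count_space_nat f_def suminf_ennreal2 sums_summable[OF sums] sums_unique[OF sums, symmetric])
  then interpret D: product_sigma_finite
      "\<lambda>_::nat. density (count_space UNIV) (\<lambda>y. ennreal (f y))"
    by (simp add: prob_space_imp_sigma_finite product_sigma_finite_def)
  have "density (count_space (samples n)) (\<lambda>Y. ennreal (likelihood n f Y))
      = (\<Pi>\<^sub>M i\<in>{..<n}. density (count_space UNIV) (\<lambda>y. ennreal (f y)))"
  proof (rule D.PiM_eqI)
    show "sets (density (count_space (samples n)) (\<lambda>Y. ennreal (likelihood n f Y)))
        = sets (\<Pi>\<^sub>M i\<in>{..<n}. density (count_space UNIV) (\<lambda>y. ennreal (f y)))"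
      unfolding sets_density PiM_count_space_nat [symmetric] by (intro sets_PiM_cong) auto
  next
    fix A :: "nat \<Rightarrow> nat set"
    have "emeasure (density (count_space (samples n)) (\<lambda>Y. ennreal (likelihood n f Y)))
            (Pi\<^sub>E {..<n} A)
        = (\<integral>\<^sup>+Y. ennreal (likelihood n f Y) * indicator (Pi\<^sub>E {..<n} A) Y \<partial>count_space (samples n))"
      by (subst emeasure_density) (auto intro!: PiE_mono)
    also have "\<dots> = (\<integral>\<^sup>+Y. (\<Prod>i\<in>{..<n}. ennreal (f (Y i)) * indicator (A i) (Y i))
        \<partial>(\<Pi>\<^sub>M i\<in>{..<n}. count_space (UNIV :: nat set)))"
      unfolding PiM_count_space_nat
    proof (intro nn_integral_cong)
      fix Y assume Y: "Y \<in> space (count_space (samples n))"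
      show "ennreal (likelihood n f Y) * indicator (Pi\<^sub>E {..<n} A) Y
          = (\<Prod>i\<in>{..<n}. ennreal (f (Y i)) * indicator (A i) (Y i))"
      proof (cases "Y \<in> Pi\<^sub>E {..<n} A")
        case True
        then show ?thesis
          by (auto simp: likelihood_def prod_ennreal nn PiE_iff intro!: prod.cong)
      next
        case False
        with Y obtain i where "i < n" "Y i \<notin> A i" by (auto simp: PiE_iff)
        then have "(\<Prod>i\<in>{..<n}. ennreal (f (Y i)) * indicator (A i) (Y i)) = 0"
          by (intro prod_zero) (auto intro!: bexI[of _ i])
        with False show ?thesis by simp
      qed
    qed
    also have "\<dots> = (\<Prod>i<n. \<integral>\<^sup>+y. ennreal (f y) * indicator (A i) y \<partial>count_space UNIV)"
      by (rule C.product_nn_integral_prod) auto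
    also have "\<dots> = (\<Prod>i<n. emeasure (density (count_space UNIV) (\<lambda>y. ennreal (f y))) (A i))"
      by (simp add: emeasure_density)
    finally show "emeasure (density (count_space (samples n)) (\<lambda>Y. ennreal (likelihood n f Y)))
            (Pi\<^sub>E {..<n} A)
        = (\<Prod>i<n. emeasure (density (count_space UNIV) (\<lambda>y. ennreal (f y))) (A i))" .
  qed auto
  then show ?thesis by (simp add: sample_law_def f_def)
qed

text \<open>Since \<open>p q = min p q \<cdot> max p q\<close>, the AM-GM inequality bounds \<open>sqrt (p q)\<close> by \<open>min p q + max p q / 4\<close>.
  Summed over the sample space, this turns a lower bound on the Hellinger affinity into a lower
  bound on the overlap of two sample laws.\<close>
lemma sqrt_mult_le_quarter_sum_plus_min:
  fixes p q :: real
  assumes "0 \<le> p" "0 \<le> q"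
  shows "sqrt (p * q) \<le> (p + q) / 4 + min p q"
proof (rule real_le_lsqrt)
  have "(min p q - max p q / 4)\<^sup>2 \<ge> 0" by simp
  then have "min p q * max p q \<le> (max p q / 4 + min p q)\<^sup>2"
    by (simp add: power2_eq_square algebra_simps)
  also have "\<dots> \<le> ((p + q) / 4 + min p q)\<^sup>2"
    using assms by (intro power_mono) (auto simp: max_def min_def)
  finally show "p * q \<le> ((p + q) / 4 + min p q)\<^sup>2"
    by (simp add: min_def max_def mult.commute split: if_splits)
qed (use assms in \<open>auto simp: min_def\<close>)

text \<open>The affinity \<open>\<Sum> sqrt (p q) = 1 - H / 2\<close> is multiplicative over independent observations, so if
  the squared Hellinger distance \<open>H\<close> is at most \<open>1 / (2 n)\<close>, then Bernoulli's inequality keeps the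
  affinity of the \<open>n\<close>-fold products at \<open>3 / 4\<close> or more. A sample of size \<open>n\<close> cannot reliably separate
  such \<open>p\<close> and \<open>q\<close>.\<close>
lemma likelihood_overlap:
  assumes p: "\<And>y. 0 \<le> p y" "p sums 1" and q: "\<And>y. 0 \<le> q y" "q sums 1"
    and H: "(\<lambda>y. (sqrt (p y) - sqrt (q y))\<^sup>2) sums H" "H \<le> 1 / (2 * real n)" and n: "0 < n"
  shows "ennreal (1 / 4) \<le>
    (\<integral>\<^sup>+Y. ennreal (min (likelihood n p Y) (likelihood n q Y)) \<partial>count_space (samples n))"
proof -
  let ?C = "count_space (samples n)"
  have "(\<lambda>y. sqrt (p y * q y)) sums (1 - H / 2)"
  proof -
    have "(\<lambda>y. (p y + q y - (sqrt (p y) - sqrt (q y))\<^sup>2) / 2) sums ((1 + 1 - H) / 2)"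
      by (intro sums_divide sums_diff sums_add p q H)
    moreover have "(p y + q y - (sqrt (p y) - sqrt (q y))\<^sup>2) / 2 = sqrt (p y * q y)" for y
      using p(1)[of y] q(1)[of y] by (simp add: power2_diff real_sqrt_mult)
    ultimately show ?thesis by (simp add: field_simps)
  qed
  then have aff: "(\<integral>\<^sup>+Y. ennreal (likelihood n (\<lambda>y. sqrt (p y * q y)) Y) \<partial>?C) = ennreal ((1 - H / 2) ^ n)"
    by (intro nn_integral_likelihood) (use p q in auto)
  have "1 + real n * (- H / 2) \<le> (1 + (- H / 2)) ^ n"
  proof (rule Bernoulli_inequality)
    have "1 / (2 * real n) \<le> 1 / 2" using n by (simp add: field_simps)
    with H(2) show "- 1 \<le> - H / 2" by linarith
  qed
  moreover have "real n * (H / 2) \<le> 1 / 4"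
    using H(2) n by (simp add: field_simps)
  ultimately have "3 / 4 \<le> (1 - H / 2) ^ n" by (simp only: minus_divide_left[symmetric] mult_minus_right add_uminus_conv_diff)
  then have "ennreal (3 / 4) \<le> (\<integral>\<^sup>+Y. ennreal (likelihood n (\<lambda>y. sqrt (p y * q y)) Y) \<partial>?C)"
    unfolding aff by (rule ennreal_leI)
  also have "\<dots> \<le> (\<integral>\<^sup>+Y. ennreal (1/4) * ennreal (likelihood n p Y) + ennreal (1/4) * ennreal (likelihood n q Y)
      + ennreal (min (likelihood n p Y) (likelihood n q Y)) \<partial>?C)"
  proof (intro nn_integral_mono)
    fix Y
    have eq: "likelihood n (\<lambda>y. sqrt (p y * q y)) Y = sqrt (likelihood n p Y * likelihood n q Y)"
      unfolding likelihood_def by (induction n) (simp_all add: real_sqrt_mult)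
    have nn: "0 \<le> likelihood n p Y" "0 \<le> likelihood n q Y"
      by (auto intro: likelihood_nonneg p q)
    have "ennreal (likelihood n (\<lambda>y. sqrt (p y * q y)) Y)
       \<le> ennreal ((likelihood n p Y + likelihood n q Y) / 4 + min (likelihood n p Y) (likelihood n q Y))"
      unfolding eq by (intro ennreal_leI sqrt_mult_le_quarter_sum_plus_min nn)
    also have "\<dots> = ennreal (1/4) * ennreal (likelihood n p Y) + ennreal (1/4) * ennreal (likelihood n q Y)
      + ennreal (min (likelihood n p Y) (likelihood n q Y))"
      using nn by (simp add: ennreal_mult[symmetric] ennreal_plus[symmetric] add_divide_distrib del: ennreal_plus)
    finally show "ennreal (likelihood n (\<lambda>y. sqrt (p y * q y)) Y) \<le> \<dots>" .
  qed
  also have "\<dots> = ennreal (1/2) + (\<integral>\<^sup>+Y. ennreal (min (likelihood n p Y) (likelihood n q Y)) \<partial>?C)"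
    using nn_integral_likelihood[of p 1 n] nn_integral_likelihood[of q 1 n] p q
    by (simp add: nn_integral_add nn_integral_cmult ennreal_plus[symmetric] del: ennreal_plus)
  finally have "ennreal (1/2) + ennreal (1/4) \<le> ennreal (1/2) +
      (\<integral>\<^sup>+Y. ennreal (min (likelihood n p Y) (likelihood n q Y)) \<partial>?C)"
    by (subst ennreal_plus[symmetric]) simp_all
  then show ?thesis
    by (subst (asm) ennreal_add_left_cancel_le) auto
qed

lemma hellinger_sq_ge_partial_sum:
  assumes p: "\<And>y. 0 \<le> p y" "summable p" and g: "prob_density (count_space UNIV) g" and I: "finite I"
  shows "(\<Sum>i\<in>I. (sqrt (p i) - sqrt (g i))\<^sup>2) \<le> (hellinger (count_space (UNIV :: nat set)) p g)\<^sup>2"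
proof -
  have g0: "0 \<le> g y" for y using g by (simp add: prob_density_def)
  have "(\<Sum>y. ennreal (g y)) = 1"
    using g by (simp add: prob_density_def nn_integral_count_space_nat)
  then have "(\<Sum>y. ennreal (g y)) \<noteq> \<top>" by (metis ennreal_one_neq_top)
  with g0 have "summable g" by (rule summable_suminf_not_top)
  have s: "summable (\<lambda>y. (sqrt (p y) - sqrt (g y))\<^sup>2)"
  proof (rule summable_comparison_test'[of "\<lambda>y. p y + g y" 0])
    show "summable (\<lambda>y. p y + g y)" by (intro summable_add p \<open>summable g\<close>)
  next
    fix y
    have "0 \<le> sqrt (p y) * sqrt (g y)" using p g0 by simp
    then show "norm ((sqrt (p y) - sqrt (g y))\<^sup>2) \<le> p y + g y"
      using p(1)[of y] g0[of y] zero_le_power2[of "sqrt (p y) - sqrt (g y)"]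
      by (simp only: real_norm_def abs_of_nonneg) (simp add: power2_diff)
  qed
  then have "integral\<^sup>L (count_space UNIV) (\<lambda>y. (sqrt (p y) - sqrt (g y))\<^sup>2) = (\<Sum>y. (sqrt (p y) - sqrt (g y))\<^sup>2)"
    by (intro integral_count_space_nat) (simp add: integrable_count_space_nat_iff)
  moreover have "0 \<le> (\<Sum>y. (sqrt (p y) - sqrt (g y))\<^sup>2)"
    by (rule suminf_nonneg[OF s]) simp
  ultimately have "(hellinger (count_space UNIV) p g)\<^sup>2 = (\<Sum>y. (sqrt (p y) - sqrt (g y))\<^sup>2)"
    unfolding hellinger_def by simp
  then show ?thesis using sum_le_suminf[OF s I] by simp
qed

text \<open>Whatever value \<open>x\<close> an estimate takes, it is far from \<open>s\<close> or from \<open>t\<close>; the weights \<open>P\<close> and \<open>Q\<close>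
  are the probabilities of the observed sample under the two hypotheses.\<close>
lemma two_point_bound:
  fixes P Q s t x \<beta> :: real
  assumes "0 \<le> P" "0 \<le> Q" "\<beta> \<le> (s - t)\<^sup>2"
  shows "\<beta> / 2 * min P Q \<le> P * (s - x)\<^sup>2 + Q * (t - x)\<^sup>2"
proof -
  have "(s - t)\<^sup>2 \<le> 2 * ((s - x)\<^sup>2 + (t - x)\<^sup>2)"
    using sum_squares_ge_zero[of "s + t - 2 * x" 0] by (simp add: power2_eq_square algebra_simps)
  with assms(3) have "\<beta> / 2 \<le> (s - x)\<^sup>2 + (t - x)\<^sup>2" by simp
  then have "\<beta> / 2 * min P Q \<le> ((s - x)\<^sup>2 + (t - x)\<^sup>2) * min P Q"
    using assms by (intro mult_right_mono) auto
  also have "\<dots> \<le> P * (s - x)\<^sup>2 + Q * (t - x)\<^sup>2"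
    unfolding distrib_right by (intro add_mono) (auto simp: mult.commute intro!: mult_right_mono)
  finally show ?thesis .
qed

lemma sum_Pow_pairs:
  fixes F :: "'a set \<Rightarrow> real"
  assumes "finite I" "i \<in> I"
  shows "(\<Sum>U\<in>Pow I. F U) = (\<Sum>U\<in>Pow (I - {i}). F U + F (insert i U))"
proof -
  have "Pow I = Pow (I - {i}) \<union> insert i ` Pow (I - {i})"
    using assms(2) Pow_insert[of i "I - {i}"] by (simp add: insert_absorb)
  moreover have "Pow (I - {i}) \<inter> insert i ` Pow (I - {i}) = {}" by auto
  moreover have "inj_on (insert i) (Pow (I - {i}))" by (auto simp: inj_on_def)
  ultimately show ?thesis
    using assms(1) by (simp add: sum.union_disjoint sum.reindex sum.distrib)
qed

text \<open>The squared Hellinger loss is a sum over the observed value \<open>y\<close>, and the part of it at \<open>y = i\<close> is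
  charged to the \<open>i\<close>-th coordinate of the hypercube. Averaging the risk over all vertices \<open>U\<close> and
  pairing \<open>U\<close> with \<open>insert i U\<close> reduces that part to a two-point problem. The perturbations need
  therefore not be orthogonal: only neighbouring vertices are compared, and coordinate \<open>i\<close> only has to
  move the density at the single point \<open>i\<close>.\<close>
lemma assouad:
  fixes f :: "nat set \<Rightarrow> nat \<Rightarrow> real"
  assumes I: "finite I" and n: "0 < n" and \<beta>: "0 \<le> \<beta>"
    and G: "\<And>U. U \<subseteq> I \<Longrightarrow> G U \<in> \<G>"
    and mix: "\<And>U. U \<subseteq> I \<Longrightarrow> poisson_mixture (G U) = f U"
    and nonneg: "\<And>U y. U \<subseteq> I \<Longrightarrow> 0 \<le> f U y"
    and sums: "\<And>U. U \<subseteq> I \<Longrightarrow> f U sums 1"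
    and close: "\<And>U i. i \<in> I \<Longrightarrow> U \<subseteq> I - {i} \<Longrightarrow>
       \<exists>H \<le> 1 / (2 * real n). (\<lambda>y. (sqrt (f U y) - sqrt (f (insert i U) y))\<^sup>2) sums H"
    and sep: "\<And>U i. i \<in> I \<Longrightarrow> U \<subseteq> I - {i} \<Longrightarrow> \<beta> \<le> (sqrt (f U i) - sqrt (f (insert i U) i))\<^sup>2"
  shows "ennreal (real (card I) * \<beta> / 16) \<le> minimax_risk n \<G>"
  unfolding minimax_risk_def
proof (rule INF_greatest)
  fix fhat assume fhat: "fhat \<in> density_estimators n"
  let ?C = "count_space (samples n)"
  define R where "R = (SUP G \<in> \<G>. \<integral>\<^sup>+Y. ennreal ((hellinger (count_space UNIV)
      (poisson_mixture G) (fhat Y))\<^sup>2) \<partial>sample_law n G)"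
  define L where "L U Y i = (sqrt (f U i) - sqrt (fhat Y i))\<^sup>2" for U Y i
  define P where "P U Y = likelihood n (f U) Y" for U Y
  have P0: "0 \<le> P U Y" if "U \<subseteq> I" for U Y
    unfolding P_def by (intro likelihood_nonneg nonneg that)
  have risk: "(\<integral>\<^sup>+Y. ennreal (P U Y * (\<Sum>i\<in>I. L U Y i)) \<partial>?C) \<le> R" if U: "U \<subseteq> I" for U
  proof -
    have law: "sample_law n (G U) = density ?C (\<lambda>Y. ennreal (P U Y))"
      unfolding P_def mix[OF U, symmetric]
      by (rule sample_law_eq_density) (use nonneg sums U in \<open>auto simp: mix\<close>)
    have "(\<integral>\<^sup>+Y. ennreal (P U Y * (\<Sum>i\<in>I. L U Y i)) \<partial>?C)
        \<le> (\<integral>\<^sup>+Y. ennreal (P U Y) * ennreal ((hellinger (count_space UNIV)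
             (poisson_mixture (G U)) (fhat Y))\<^sup>2) \<partial>?C)"
    proof (intro nn_integral_mono)
      fix Y assume "Y \<in> space ?C"
      then have "prob_density (count_space UNIV) (fhat Y)"
        using fhat by (simp add: density_estimators_def PiM_count_space_nat)
      then have "(\<Sum>i\<in>I. L U Y i) \<le> (hellinger (count_space UNIV) (poisson_mixture (G U)) (fhat Y))\<^sup>2"
        unfolding L_def mix[OF U]
        by (intro hellinger_sq_ge_partial_sum I nonneg[OF U] sums_summable[OF sums[OF U]])
      then show "ennreal (P U Y * (\<Sum>i\<in>I. L U Y i)) \<le> ennreal (P U Y) * ennreal ((hellinger (count_space UNIV)
             (poisson_mixture (G U)) (fhat Y))\<^sup>2)"
        using P0[OF U] by (subst ennreal_mult[symmetric]) (auto intro!: ennreal_leI mult_left_mono)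
    qed
    also have "\<dots> = (\<integral>\<^sup>+Y. ennreal ((hellinger (count_space UNIV)
             (poisson_mixture (G U)) (fhat Y))\<^sup>2) \<partial>sample_law n (G U))"
      unfolding law by (subst nn_integral_density) auto
    also have "\<dots> \<le> R" unfolding R_def by (intro SUP_upper G U)
    finally show ?thesis .
  qed
  let ?N = "card I * 2 ^ (card I - 1)"
  have "ennreal (real ?N * (\<beta> / 8)) = (\<Sum>i\<in>I. \<Sum>U\<in>Pow (I - {i}). ennreal (\<beta> / 2) * ennreal (1 / 4))"
    using I \<beta> by (simp add: ennreal_mult[symmetric] card_Pow ennreal_of_nat_eq_real_of_nat del: ennreal_mult)
  also have "\<dots> \<le> (\<Sum>i\<in>I. \<Sum>U\<in>Pow (I - {i}). ennreal (\<beta> / 2) *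
      (\<integral>\<^sup>+Y. ennreal (min (P U Y) (P (insert i U) Y)) \<partial>?C))"
  proof (intro sum_mono mult_left_mono)
    fix i U assume i: "i \<in> I" and "U \<in> Pow (I - {i})"
    then have U: "U \<subseteq> I - {i}" "U \<subseteq> I" "insert i U \<subseteq> I" by auto
    obtain H where "H \<le> 1 / (2 * real n)" "(\<lambda>y. (sqrt (f U y) - sqrt (f (insert i U) y))\<^sup>2) sums H"
      using close[OF i U(1)] by blast
    then show "ennreal (1 / 4) \<le> (\<integral>\<^sup>+Y. ennreal (min (P U Y) (P (insert i U) Y)) \<partial>?C)"
      unfolding P_def by (intro likelihood_overlap) (use U n nonneg sums in auto)
  qed auto
  also have "\<dots> = (\<integral>\<^sup>+Y. ennreal (\<Sum>i\<in>I. \<Sum>U\<in>Pow (I - {i}). \<beta> / 2 * min (P U Y) (P (insert i U) Y)) \<partial>?C)"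
  proof -
    have nn: "0 \<le> \<beta> / 2 * min (P U Y) (P (insert i U) Y)" if "i \<in> I" "U \<in> Pow (I - {i})" for i U Y
      using that P0[of U Y] P0[of "insert i U" Y] \<beta> by (intro mult_nonneg_nonneg) auto
    have "ennreal (\<Sum>i\<in>I. \<Sum>U\<in>Pow (I - {i}). \<beta> / 2 * min (P U Y) (P (insert i U) Y))
      = (\<Sum>i\<in>I. \<Sum>U\<in>Pow (I - {i}). ennreal (\<beta> / 2) * ennreal (min (P U Y) (P (insert i U) Y)))" for Y
    proof -
      have "(\<Sum>i\<in>I. \<Sum>U\<in>Pow (I - {i}). ennreal (\<beta> / 2) * ennreal (min (P U Y) (P (insert i U) Y)))
        = (\<Sum>i\<in>I. \<Sum>U\<in>Pow (I - {i}). ennreal (\<beta> / 2 * min (P U Y) (P (insert i U) Y)))"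
        using \<beta> by (intro sum.cong refl ennreal_mult'[symmetric]) auto
      also have "\<dots> = (\<Sum>i\<in>I. ennreal (\<Sum>U\<in>Pow (I - {i}). \<beta> / 2 * min (P U Y) (P (insert i U) Y)))"
        by (intro sum.cong refl sum_ennreal nn)
      also have "\<dots> = ennreal (\<Sum>i\<in>I. \<Sum>U\<in>Pow (I - {i}). \<beta> / 2 * min (P U Y) (P (insert i U) Y))"
        by (intro sum_ennreal sum_nonneg nn)
      finally show ?thesis by simp
    qed
    then show ?thesis
      by (simp add: nn_integral_sum nn_integral_cmult)
  qed
  also have "\<dots> \<le> (\<integral>\<^sup>+Y. ennreal (\<Sum>U\<in>Pow I. P U Y * (\<Sum>i\<in>I. L U Y i)) \<partial>?C)"
  proof (intro nn_integral_mono ennreal_leI)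
    fix Y
    have "(\<Sum>i\<in>I. \<Sum>U\<in>Pow (I - {i}). \<beta> / 2 * min (P U Y) (P (insert i U) Y))
      \<le> (\<Sum>i\<in>I. \<Sum>U\<in>Pow (I - {i}). P U Y * L U Y i + P (insert i U) Y * L (insert i U) Y i)"
      unfolding L_def by (intro sum_mono two_point_bound P0 sep) auto
    also have "\<dots> = (\<Sum>i\<in>I. \<Sum>U\<in>Pow I. P U Y * L U Y i)"
      by (intro sum.cong refl sum_Pow_pairs[symmetric] I)
    also have "\<dots> = (\<Sum>U\<in>Pow I. P U Y * (\<Sum>i\<in>I. L U Y i))"
      by (subst sum.swap) (simp add: sum_distrib_left)
    finally show "(\<Sum>i\<in>I. \<Sum>U\<in>Pow (I - {i}). \<beta> / 2 * min (P U Y) (P (insert i U) Y)) \<le> \<dots>" .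
  qed
  also have "\<dots> = (\<integral>\<^sup>+Y. (\<Sum>U\<in>Pow I. ennreal (P U Y * (\<Sum>i\<in>I. L U Y i))) \<partial>?C)"
    by (intro nn_integral_cong sum_ennreal[symmetric] mult_nonneg_nonneg sum_nonneg P0)
      (auto simp: L_def)
  also have "\<dots> = (\<Sum>U\<in>Pow I. \<integral>\<^sup>+Y. ennreal (P U Y * (\<Sum>i\<in>I. L U Y i)) \<partial>?C)"
    by (intro nn_integral_sum) auto
  also have "\<dots> \<le> (\<Sum>U\<in>Pow I. R)" by (intro sum_mono risk) auto
  also have "\<dots> = ennreal (2 ^ card I) * R" using I by (simp add: card_Pow ennreal_of_nat_eq_real_of_nat)
  finally have main: "ennreal (real ?N * (\<beta> / 8)) \<le> ennreal (2 ^ card I) * R" .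
  have "real ?N * (\<beta> / 8) = 2 ^ card I * (real (card I) * \<beta> / 16)"
    by (cases "card I") (simp_all add: algebra_simps)
  with main have "ennreal (2 ^ card I * (real (card I) * \<beta> / 16)) \<le> ennreal (2 ^ card I) * R" by (simp only:)
  then have "ennreal (2 ^ card I) * ennreal (real (card I) * \<beta> / 16) \<le> ennreal (2 ^ card I) * R"
    using \<beta> by (subst ennreal_mult[symmetric]) simp_all
  then show "ennreal (real (card I) * \<beta> / 16) \<le> (SUP G \<in> \<G>. \<integral>\<^sup>+Y. ennreal ((hellinger (count_space UNIV)
      (poisson_mixture G) (fhat Y))\<^sup>2) \<partial>sample_law n G)"
    unfolding R_def[symmetric] by (subst (asm) ennreal_mult_le_mult_iff) auto
qed

section \<open>Interpolation on an equispaced grid\<close>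

text \<open>The coefficients of \<open>\<Prod> (x - c l)\<close> are dominated by those of \<open>\<Prod> (x + \<bar>c l\<bar>)\<close>, which are
  nonnegative, so that each single term is at most the value of the whole polynomial at \<open>t\<close>.\<close>
lemma abs_coeff_prod_linear_le:
  fixes c :: "'a \<Rightarrow> real"
  assumes "finite S" "0 \<le> t"
  shows "\<bar>coeff (\<Prod>l\<in>S. [:- c l, 1:]) i\<bar> * t ^ i \<le> (\<Prod>l\<in>S. t + \<bar>c l\<bar>)"
  using assms(1)
proof (induction S arbitrary: i rule: finite_induct)
  case empty
  then show ?case using assms(2) by (cases i) auto
next
  case (insert x S)
  let ?p = "\<Prod>l\<in>S. [:- c l, 1:]"
  let ?b = "\<Prod>l\<in>S. t + \<bar>c l\<bar>"
  have shift: "\<bar>coeff (pCons 0 ?p) i\<bar> * t ^ i \<le> t * ?b"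
  proof (cases i)
    case 0
    then show ?thesis using assms(2) by (auto intro!: mult_nonneg_nonneg prod_nonneg)
  next
    case (Suc j)
    then show ?thesis using mult_left_mono[OF insert.IH[of j] assms(2)] by (simp add: algebra_simps)
  qed
  have "coeff ([:- c x, 1:] * ?p) i = coeff (pCons 0 ?p) i - c x * coeff ?p i"
    by simp
  then have "\<bar>coeff ([:- c x, 1:] * ?p) i\<bar> \<le> \<bar>coeff (pCons 0 ?p) i\<bar> + \<bar>c x\<bar> * \<bar>coeff ?p i\<bar>"
    by (metis abs_mult abs_triangle_ineq4)
  then have "\<bar>coeff ([:- c x, 1:] * ?p) i\<bar> * t ^ i
      \<le> (\<bar>coeff (pCons 0 ?p) i\<bar> + \<bar>c x\<bar> * \<bar>coeff ?p i\<bar>) * t ^ i"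
    using assms(2) by (intro mult_right_mono) auto
  also have "\<dots> = \<bar>coeff (pCons 0 ?p) i\<bar> * t ^ i + \<bar>c x\<bar> * (\<bar>coeff ?p i\<bar> * t ^ i)"
    by (simp add: algebra_simps)
  also have "\<dots> \<le> t * ?b + \<bar>c x\<bar> * ?b"
    by (intro add_mono shift mult_left_mono insert.IH) auto
  finally show ?case using insert.hyps by (simp add: algebra_simps)
qed

definition lagrange_basis :: "nat \<Rightarrow> nat \<Rightarrow> real poly" where
  "lagrange_basis M k =
     smult (inverse (\<Prod>l\<in>{..M} - {k}. real k - real l)) (\<Prod>l\<in>{..M} - {k}. [:- real l, 1:])"

lemma poly_lagrange_basis:
  assumes "k \<le> M" "j \<le> M"
  shows "poly (lagrange_basis M k) (real j) = (if j = k then 1 else 0)"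
  using assms by (auto simp: lagrange_basis_def poly_prod)

lemma degree_lagrange_basis:
  assumes "k \<le> M"
  shows "degree (lagrange_basis M k) \<le> M"
proof -
  have "degree (\<Prod>l\<in>{..M} - {k}. [:- real l, 1:]) \<le> (\<Sum>l\<in>{..M} - {k}. degree [:- real l, 1:])"
    using degree_prod_sum_le[of "{..M} - {k}" "\<lambda>l. [:- real l, 1:]"] by (simp add: comp_def)
  also have "\<dots> = M" using assms by simp
  finally show ?thesis
    unfolding lagrange_basis_def using degree_smult_le le_trans by blast
qed

text \<open>Interpolating \<open>x ^ j\<close> at the nodes \<open>0, \<dots>, M\<close> reproduces it; compare the coefficients of \<open>x ^ i\<close>.
  The node \<open>0\<close> drops out of the sum because \<open>j \<ge> 1\<close>, which leaves the mass there free to be used for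
  another purpose.\<close>
lemma lagrange_basis_moments:
  assumes "1 \<le> j" "j \<le> M"
  shows "(\<Sum>k\<in>{1..M}. real k ^ j * coeff (lagrange_basis M k) i) = (if i = j then 1 else 0)"
proof -
  let ?p = "\<Sum>k\<in>{1..M}. smult (real k ^ j) (lagrange_basis M k)"
  have "?p = monom 1 j"
  proof (rule poly_eqI_degree[where A = "real ` {..M}"])
    fix x assume "x \<in> real ` {..M}"
    then obtain l where l: "l \<le> M" "x = real l" by auto
    have "poly ?p x = (\<Sum>k\<in>{1..M}. if k = l then real k ^ j else 0)"
      unfolding poly_sum l(2)
      by (intro sum.cong refl) (use l in \<open>auto simp: poly_lagrange_basis\<close>)
    also have "\<dots> = real l ^ j" using l assms by (cases "l = 0") auto
    finally show "poly ?p x = poly (monom 1 j) x" using l by (simp add: poly_monom)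
  next
    have "card (real ` {..M}) = Suc M" by (subst card_image) (auto intro: inj_onI)
    moreover have "degree ?p \<le> M"
    proof (rule degree_sum_le)
      fix k assume "k \<in> {1..M}"
      then show "degree (smult (real k ^ j) (lagrange_basis M k)) \<le> M"
        by (intro order.trans[OF degree_smult_le degree_lagrange_basis]) auto
    qed simp
    moreover have "degree (monom 1 j :: real poly) \<le> M" using assms by (simp add: degree_monom_eq)
    ultimately show "degree ?p < card (real ` {..M})"
      "degree (monom 1 j :: real poly) < card (real ` {..M})" by auto
  qed
  then have "coeff ?p i = coeff (monom 1 j) i" by simp
  then show ?thesis by (auto simp: coeff_sum)
qed

lemma prod_abs_diff_eq_fact:
  assumes "k \<le> M"
  shows "(\<Prod>l\<in>{..M} - {k}. \<bar>real k - real l\<bar>) = fact k * fact (M - k)"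
  using assms
proof (induction M rule: dec_induct)
  case base
  have "{..k} - {k} = {0..<k}" by auto
  then have "(\<Prod>l\<in>{..k} - {k}. \<bar>real k - real l\<bar>) = (\<Prod>l\<in>{0..<k}. real (k - l))"
    by (auto intro!: prod.cong simp: of_nat_diff)
  also have "\<dots> = fact k" unfolding fact_prod_rev by simp
  finally show ?case by simp
next
  case (step M)
  have "{..Suc M} - {k} = insert (Suc M) ({..M} - {k})" using step by auto
  moreover have "\<bar>real k - real (Suc M)\<bar> = real (Suc (M - k))" using step by auto
  ultimately show ?case using step by (simp add: Suc_diff_le)
qed

text \<open>The numerator is estimated at \<open>t = M\<close>, where it is at most \<open>(2 M) ^ M\<close>. The denominator is
  \<open>k! (M - k)! = M! / (M choose k)\<close>, which is at least \<open>(M / (2 e)) ^ M\<close>. What matters is that the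
  quotient is only exponential in \<open>M\<close>.\<close>
lemma abs_coeff_lagrange_basis_le:
  assumes "1 \<le> M" "k \<le> M"
  shows "\<bar>coeff (lagrange_basis M k) i\<bar> * real M ^ i \<le> (4 * exp 1) ^ M"
proof -
  let ?S = "{..M} - {k}"
  have den: "\<bar>\<Prod>l\<in>?S. real k - real l\<bar> = fact k * fact (M - k)"
    using prod_abs_diff_eq_fact[OF assms(2)] by (simp add: abs_prod)
  have "\<bar>coeff (\<Prod>l\<in>?S. [:- real l, 1:]) i\<bar> * real M ^ i \<le> (\<Prod>l\<in>?S. real M + \<bar>real l\<bar>)"
    by (rule abs_coeff_prod_linear_le) auto
  also have "\<dots> \<le> (\<Prod>l\<in>?S. 2 * real M)"
    by (intro prod_mono) auto
  also have "\<dots> = (2 * real M) ^ M" using assms by simp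
  finally have num: "\<bar>coeff (\<Prod>l\<in>?S. [:- real l, 1:]) i\<bar> * real M ^ i \<le> (2 * real M) ^ M" .
  have "real (M choose k) \<le> 2 ^ M"
    using binomial_le_pow2[of M k] by (metis of_nat_le_iff of_nat_numeral of_nat_power)
  then have choose: "fact M / 2 ^ M \<le> fact k * (fact (M - k) :: real)"
    using assms by (simp add: binomial_fact field_simps)
  have "(\<Sum>n\<in>{M}. real M ^ n /\<^sub>R fact n) \<le> exp (real M)"
    unfolding exp_def by (rule sum_le_suminf) (auto simp: summable_exp)
  then have stirling: "real M ^ M \<le> exp 1 ^ M * fact M"
    using exp_of_nat_mult[of M "1 :: real"] by (simp add: divide_simps)
  have "\<bar>coeff (lagrange_basis M k) i\<bar> * real M ^ i
      = \<bar>coeff (\<Prod>l\<in>?S. [:- real l, 1:]) i\<bar> * real M ^ i / (fact k * fact (M - k))"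
    by (simp add: lagrange_basis_def abs_mult den[symmetric] divide_inverse)
  also have "\<dots> \<le> (2 * real M) ^ M / (fact M / 2 ^ M)"
    by (intro frac_le num choose) auto
  also have "\<dots> = 4 ^ M * real M ^ M / fact M"
    using power_mult_distrib[of "2 :: real" 2 M] by (simp add: power_mult_distrib)
  also have "\<dots> \<le> 4 ^ M * (exp 1 ^ M * fact M) / fact M"
    by (intro divide_right_mono mult_left_mono stirling) auto
  also have "\<dots> = (4 * exp 1) ^ M" by (simp add: power_mult_distrib)
  finally show ?thesis .
qed

text \<open>Masses at the nodes \<open>a k\<close> whose \<open>i\<close>-th power moment is \<open>i!\<close> and whose other moments of the orders
  \<open>1, \<dots>, M\<close> vanish. Multiplied by \<open>exp (a k)\<close>, they form a signed prior whose Poisson mixture is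
  the unit mass at \<open>i\<close>, as far as the values \<open>1, \<dots>, M\<close> are concerned.\<close>
definition dual_weight :: "real \<Rightarrow> nat \<Rightarrow> nat \<Rightarrow> nat \<Rightarrow> real" where
  "dual_weight a M i k = fact i / a ^ i * coeff (lagrange_basis M k) i"

lemma dual_weight_moments:
  assumes "a \<noteq> 0" "1 \<le> j" "j \<le> M"
  shows "(\<Sum>k\<in>{1..M}. dual_weight a M i k * ((a * real k) ^ j / fact j)) = (if i = j then 1 else 0)"
proof -
  have "(\<Sum>k\<in>{1..M}. dual_weight a M i k * ((a * real k) ^ j / fact j))
      = fact i / a ^ i * (a ^ j / fact j) * (\<Sum>k\<in>{1..M}. real k ^ j * coeff (lagrange_basis M k) i)"
    unfolding sum_distrib_left
    by (intro sum.cong refl) (simp add: dual_weight_def power_mult_distrib)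
  then show ?thesis
    using assms by (simp only: lagrange_basis_moments[OF assms(2,3)]) simp
qed

text \<open>The factorial costs nothing: \<open>i! \<le> M ^ i\<close> is absorbed by the factor \<open>M ^ i\<close> in
  \<open>abs_coeff_lagrange_basis_le\<close>.\<close>
lemma abs_dual_weight_le:
  assumes "0 < a" "1 \<le> M" "i \<le> M" "k \<le> M"
  shows "\<bar>dual_weight a M i k\<bar> \<le> (1 / a) ^ i * (4 * exp 1) ^ M"
proof -
  have "(fact i :: real) \<le> real i ^ i" using fact_le_power[of i, where 'a = real] by simp
  also have "\<dots> \<le> real M ^ i" using assms by (intro power_mono) auto
  finally have "fact i * \<bar>coeff (lagrange_basis M k) i\<bar> \<le> real M ^ i * \<bar>coeff (lagrange_basis M k) i\<bar>"
    by (intro mult_right_mono) auto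
  also have "\<dots> \<le> (4 * exp 1) ^ M"
    using abs_coeff_lagrange_basis_le[OF assms(2,4), of i] by (simp add: mult.commute)
  finally have "(1 / a) ^ i * (fact i * \<bar>coeff (lagrange_basis M k) i\<bar>) \<le> (1 / a) ^ i * (4 * exp 1) ^ M"
    using assms by (intro mult_left_mono) auto
  then show ?thesis
    using assms by (simp add: dual_weight_def abs_mult power_divide)
qed

section \<open>Priors supported on a grid\<close>
definition poisson :: "real \<Rightarrow> nat \<Rightarrow> real" where
  "poisson \<theta> y = exp (- \<theta>) * (\<theta> ^ y / fact y)"

lemma power_div_fact_sums: "(\<lambda>y. \<theta> ^ y / fact y) sums exp (\<theta> :: real)"
  using exp_converges[of \<theta>] by (simp add: divide_inverse mult.commute)

lemma poisson_sums: "poisson \<theta> sums 1"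
  using sums_mult[OF power_div_fact_sums, of "exp (- \<theta>)" \<theta>]
  by (simp add: poisson_def[abs_def] exp_minus)

lemma poisson_nonneg: "0 \<le> \<theta> \<Longrightarrow> 0 \<le> poisson \<theta> y"
  by (simp add: poisson_def)

definition grid_prior :: "real \<Rightarrow> nat \<Rightarrow> (nat \<Rightarrow> real) \<Rightarrow> real measure" where
  "grid_prior a M w =
     distr (measure_pmf (embed_pmf (\<lambda>k. if k \<le> M then w k else 0))) borel (\<lambda>k. a * real k)"

text \<open>The weights may have any sign here, so that perturbations of a prior are covered as well.\<close>
definition grid_mixture :: "real \<Rightarrow> nat \<Rightarrow> (nat \<Rightarrow> real) \<Rightarrow> nat \<Rightarrow> real" where
  "grid_mixture a M w y = (\<Sum>k\<le>M. w k * poisson (a * real k) y)"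

lemma grid_mixture_sums: "grid_mixture a M w sums (\<Sum>k\<le>M. w k)"
  unfolding grid_mixture_def[abs_def]
  using sums_sum[of "{..M}" "\<lambda>k y. w k * poisson (a * real k) y" "\<lambda>k. w k * 1"]
    sums_mult[OF poisson_sums] by simp

lemma atMost_eq_insert_zero: "{..M :: nat} = insert 0 {1..M}"
  by auto

lemma
  assumes w: "\<And>k. k \<le> M \<Longrightarrow> 0 \<le> w k" and sum_w: "(\<Sum>k\<le>M. w k) = 1"
  shows prob_space_grid_prior: "prob_space (grid_prior a M w)"
    and measure_grid_prior:
      "A \<in> sets borel \<Longrightarrow> measure (grid_prior a M w) A = (\<Sum>k\<le>M. w k * indicator A (a * real k))"
    and poisson_mixture_grid_prior: "poisson_mixture (grid_prior a M w) = grid_mixture a M w"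
proof -
  define v where "v k = (if k \<le> M then w k else 0)" for k
  define P where "P = embed_pmf v"
  have G: "grid_prior a M w = distr (measure_pmf P) borel (\<lambda>k. a * real k)"
    by (simp add: grid_prior_def P_def v_def[abs_def])
  have v0: "0 \<le> v k" for k using w by (simp add: v_def)
  have "(\<integral>\<^sup>+k. ennreal (v k) \<partial>count_space UNIV) = (\<Sum>k\<le>M. ennreal (v k))"
    by (intro nn_integral_count_space') (auto simp: v_def)
  also have "\<dots> = ennreal (\<Sum>k\<le>M. v k)" using v0 by (intro sum_ennreal) auto
  also have "\<dots> = 1" using sum_w by (simp add: v_def)
  finally have pmf: "pmf P k = v k" for k
    unfolding P_def by (intro pmf_embed_pmf v0)
  show "prob_space (grid_prior a M w)"
    unfolding G by (intro prob_space.prob_space_distr) (auto intro: measure_pmf.prob_space_axioms)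
  have integral: "(\<integral>k. g k \<partial>measure_pmf P) = (\<Sum>k\<le>M. w k * g k)" for g :: "nat \<Rightarrow> real"
    by (subst integral_measure_pmf_real[of "{..M}"])
      (auto simp: set_pmf_eq pmf v_def mult.commute split: if_splits)
  show "measure (grid_prior a M w) A = (\<Sum>k\<le>M. w k * indicator A (a * real k))"
    if A: "A \<in> sets borel" for A
  proof -
    have "measure (grid_prior a M w) A = measure (measure_pmf P) ((\<lambda>k. a * real k) -` A)"
      unfolding G using A by (subst measure_distr) auto
    also have "\<dots> = (\<integral>k. indicator ((\<lambda>k. a * real k) -` A) k \<partial>measure_pmf P)"
      by simp
    also have "\<dots> = (\<Sum>k\<le>M. w k * indicator A (a * real k))"
      unfolding integral by (intro sum.cong) (auto split: split_indicator)
    finally show ?thesis .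
  qed
  show "poisson_mixture (grid_prior a M w) = grid_mixture a M w"
  proof
    fix y
    have "poisson_mixture (grid_prior a M w) y = (\<integral>k. poisson (a * real k) y \<partial>measure_pmf P)"
      unfolding poisson_mixture_def G poisson_def by (subst integral_distr) auto
    then show "poisson_mixture (grid_prior a M w) y = grid_mixture a M w y"
      by (simp add: integral grid_mixture_def)
  qed
qed

lemma grid_prior_in_compact_priors:
  assumes "\<And>k. k \<le> M \<Longrightarrow> 0 \<le> w k" "(\<Sum>k\<le>M. w k) = 1" "0 \<le> a" "a * real M \<le> h"
  shows "grid_prior a M w \<in> compact_priors h"
proof -
  have in_h: "a * real k \<in> {0..h}" if "k \<le> M" for k
    using assms(3,4) that mult_left_mono[of "real k" "real M" a] by auto
  have "measure (grid_prior a M w) {0..h} = (\<Sum>k\<le>M. w k)"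
    using in_h by (subst measure_grid_prior[OF assms(1,2)]) (auto intro!: sum.cong simp: indicator_def)
  moreover have "measure (grid_prior a M w) {0..} = (\<Sum>k\<le>M. w k)"
    using in_h by (subst measure_grid_prior[OF assms(1,2)]) (auto intro!: sum.cong simp: indicator_def)
  moreover have "prob_space (grid_prior a M w)"
    by (rule prob_space_grid_prior[OF assms(1,2)])
  ultimately show ?thesis
    using assms(2) by (simp add: compact_priors_def priors_def grid_prior_def)
qed

lemma grid_prior_in_SubE:
  assumes w: "\<And>k. k \<le> M \<Longrightarrow> 0 \<le> w k" "(\<Sum>k\<le>M. w k) = 1" and a: "0 \<le> a" and s: "0 < s"
    and tail: "(\<Sum>k\<in>{1..M}. w k) \<le> 2 * exp (- (a * real M) / s)"
  shows "grid_prior a M w \<in> SubE s"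
proof -
  have "measure (grid_prior a M w) {t..} \<le> 2 * exp (- t / s)" if t: "0 < t" for t
  proof (cases "t \<le> a * real M")
    case True
    have "measure (grid_prior a M w) {t..} = (\<Sum>k\<in>{1..M}. w k * indicator {t..} (a * real k))"
      by (subst measure_grid_prior[OF w])
        (use t in \<open>auto intro!: sum.mono_neutral_right gr0I simp: indicator_def Suc_le_eq\<close>)
    also have "\<dots> \<le> (\<Sum>k\<in>{1..M}. w k)"
      using w(1) by (intro sum_mono) (auto split: split_indicator)
    also have "\<dots> \<le> 2 * exp (- (a * real M) / s)" by (rule tail)
    also have "\<dots> \<le> 2 * exp (- t / s)" using True s by (simp add: divide_right_mono)
    finally show ?thesis .
  next
    case False
    have below: "a * real k < t" if "k \<le> M" for k
      using False a that mult_left_mono[of "real k" "real M" a] by auto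
    have "measure (grid_prior a M w) {t..} = 0"
      by (subst measure_grid_prior[OF w]) (auto intro!: sum.neutral simp: indicator_def dest!: below)
    then show ?thesis by simp
  qed
  moreover have "grid_prior a M w \<in> priors"
    using grid_prior_in_compact_priors[OF w a order.refl] by (simp add: compact_priors_def)
  ultimately show ?thesis by (simp add: SubE_def)
qed

section \<open>A hypercube of perturbed grid priors\<close>

text \<open>If \<open>p\<close> and \<open>q\<close> are comparable to \<open>c\<close>, then \<open>sqrt p - sqrt q = (p - q) / (sqrt p + sqrt q)\<close>
  makes the squared Hellinger distance comparable to a chi-square distance with reference \<open>c\<close>; the
  next two lemmas give the two directions.\<close>
lemma sq_diff_sqrt_le:
  fixes p q c :: real
  assumes "0 < c" "c / 2 \<le> p" "c / 2 \<le> q"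
  shows "(sqrt p - sqrt q)\<^sup>2 \<le> (p - q)\<^sup>2 / c"
proof -
  have pq: "0 \<le> p" "0 \<le> q" using assms by auto
  then have "c \<le> (sqrt p + sqrt q)\<^sup>2" using assms by (simp add: power2_sum add.commute add_increasing2)
  then have "(sqrt p - sqrt q)\<^sup>2 * c \<le> (sqrt p - sqrt q)\<^sup>2 * (sqrt p + sqrt q)\<^sup>2"
    by (intro mult_left_mono) auto
  also have "\<dots> = (p - q)\<^sup>2"
    unfolding power_mult_distrib[symmetric] using pq by (simp add: algebra_simps)
  finally show ?thesis using assms by (simp add: field_simps)
qed

lemma sq_diff_sqrt_ge:
  fixes p q c :: real
  assumes "0 < c" "0 \<le> p" "p \<le> 3 / 2 * c" "0 \<le> q" "q \<le> 3 / 2 * c"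
  shows "(p - q)\<^sup>2 / (6 * c) \<le> (sqrt p - sqrt q)\<^sup>2"
proof -
  have "0 \<le> (sqrt p - sqrt q)\<^sup>2" by simp
  then have "(sqrt p + sqrt q)\<^sup>2 \<le> 6 * c"
    unfolding power2_sum power2_diff using assms by simp
  then have "(sqrt p - sqrt q)\<^sup>2 * (sqrt p + sqrt q)\<^sup>2 \<le> (sqrt p - sqrt q)\<^sup>2 * (6 * c)"
    by (intro mult_left_mono) auto
  moreover have "(sqrt p - sqrt q)\<^sup>2 * (sqrt p + sqrt q)\<^sup>2 = (p - q)\<^sup>2"
    unfolding power_mult_distrib[symmetric] using assms by (simp add: algebra_simps)
  ultimately show ?thesis using assms by (simp add: field_simps)
qed

text \<open>The grid is \<open>0, a, \<dots>, a M\<close>, the mass of the base prior at each positive node is \<open>p\<close>, and \<open>m\<close> is the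
  dimension of the hypercube. The number \<open>R\<close> bounds the density of the signed priors relative to the
  base prior on the positive nodes. \<open>R_le\<close> makes perturbations of size \<open>1 / sqrt n\<close> leave all masses
  positive. \<open>tail\<close> says that the base mixture has so little mass beyond \<open>M\<close> that the uncontrolled part
  of the perturbations, which is at most \<open>R\<close> times the base mixture there, is negligible.\<close>
locale perturbed_grid =
  fixes a p R :: real and m M n :: nat
  assumes a: "0 < a" "a \<le> 1" and m: "m \<le> M" and M: "1 \<le> M" and n: "0 < n"
    and p: "0 < p" "real M * p \<le> 1 / 2"
    and R: "1 \<le> R" "exp (a * real M) * ((1 / a) ^ m * (4 * exp 1) ^ M) \<le> R * p"
    and R_le: "2 * real m * R \<le> sqrt (real n)"
    and tail: "R\<^sup>2 * (p * real M * a ^ M * exp (real M)) \<le> 1"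
begin

definition base :: "nat \<Rightarrow> real" where
  "base k = (if k = 0 then 1 - real M * p else p)"

text \<open>The mass at node \<open>0\<close> makes the total mass vanish. A point mass at \<open>0\<close> only affects the mixture at
  \<open>y = 0\<close>, so the values at \<open>1, \<dots>, M\<close> prescribed by the interpolation are not disturbed.\<close>
definition direction :: "nat \<Rightarrow> nat \<Rightarrow> real" where
  "direction i k =
     (if k = 0 then - (\<Sum>l\<in>{1..M}. exp (a * real l) * dual_weight a M i l)
      else exp (a * real k) * dual_weight a M i k)"

definition f0 :: "nat \<Rightarrow> real" where
  "f0 = grid_mixture a M base"

definition \<phi> :: "nat \<Rightarrow> nat \<Rightarrow> real" where
  "\<phi> i = grid_mixture a M (direction i)"

text \<open>The step sizes are as large as indistinguishability of neighbours permits: the perturbation at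
  \<open>y = i\<close> is the standard deviation of an empirical frequency, up to a constant.\<close>
definition \<tau> :: "nat \<Rightarrow> real" where
  "\<tau> i = sqrt (f0 i / (20 * real n))"

definition weights :: "nat set \<Rightarrow> nat \<Rightarrow> real" where
  "weights U k = base k + (\<Sum>i\<in>U. \<tau> i * direction i k)"

lemma sum_base: "(\<Sum>k\<le>M. base k) = 1"
  by (simp add: atMost_eq_insert_zero base_def)

lemma sum_direction: "(\<Sum>k\<le>M. direction i k) = 0"
  by (simp add: atMost_eq_insert_zero direction_def)

lemma base_pos: "0 < base k"
  using p by (simp add: base_def)

lemma f0_pos: "0 < f0 y"
proof -
  have "0 < base 1 * poisson (a * real 1) y"
    using base_pos[of 1] a by (simp add: poisson_def)
  also have "\<dots> = (\<Sum>k\<in>{1}. base k * poisson (a * real k) y)" by simp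
  also have "\<dots> \<le> f0 y"
    unfolding f0_def grid_mixture_def using M a base_pos
    by (intro sum_mono2) (auto intro!: mult_nonneg_nonneg poisson_nonneg less_imp_le[OF base_pos])
  finally show ?thesis .
qed

lemma f0_sums: "f0 sums 1"
  using grid_mixture_sums[of a M base] by (simp add: f0_def sum_base)

lemma f0_le_1: "f0 y \<le> 1"
proof -
  have "(\<Sum>y\<in>{y}. f0 y) \<le> suminf f0"
    using f0_sums by (intro sum_le_suminf) (auto simp: sums_summable intro: less_imp_le[OF f0_pos])
  then show ?thesis using sums_unique[OF f0_sums] by simp
qed

lemma f0_0_ge: "1 / 2 \<le> f0 0"
proof -
  have "1 / 2 \<le> base 0" using p by (simp add: base_def)
  also have "base 0 = (\<Sum>k\<in>{0}. base k * poisson (a * real k) 0)" by (simp add: poisson_def)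
  also have "\<dots> \<le> f0 0"
    unfolding f0_def grid_mixture_def using a base_pos
    by (intro sum_mono2) (auto intro!: mult_nonneg_nonneg poisson_nonneg less_imp_le[OF base_pos])
  finally show ?thesis .
qed

lemma grid_mixture_pos_arg:
  assumes "1 \<le> y"
  shows "grid_mixture a M w y = (\<Sum>k\<in>{1..M}. w k * poisson (a * real k) y)"
  using assms by (simp add: grid_mixture_def atMost_eq_insert_zero poisson_def)

lemma \<phi>_eq:
  assumes "1 \<le> j" "j \<le> M"
  shows "\<phi> i j = (if i = j then 1 else 0)"
proof -
  have "\<phi> i j = (\<Sum>k\<in>{1..M}. dual_weight a M i k * ((a * real k) ^ j / fact j))"
    unfolding \<phi>_def grid_mixture_pos_arg[OF assms(1)]
    by (intro sum.cong) (auto simp: direction_def poisson_def exp_minus)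
  then show ?thesis using dual_weight_moments[of a j M i] a assms by simp
qed

lemma abs_direction_le:
  assumes "i \<le> m" "1 \<le> k" "k \<le> M"
  shows "\<bar>direction i k\<bar> \<le> R * p"
proof -
  have "\<bar>dual_weight a M i k\<bar> \<le> (1 / a) ^ i * (4 * exp 1) ^ M"
    using assms a M m by (intro abs_dual_weight_le) auto
  also have "\<dots> \<le> (1 / a) ^ m * (4 * exp 1) ^ M"
    using assms a by (intro mult_right_mono power_increasing) auto
  finally have "exp (a * real k) * \<bar>dual_weight a M i k\<bar>
      \<le> exp (a * real M) * ((1 / a) ^ m * (4 * exp 1) ^ M)"
    using assms a by (intro mult_mono) auto
  with R(2) assms show ?thesis by (simp add: direction_def abs_mult)
qed

lemma abs_\<phi>_le:
  assumes "i \<le> m" "1 \<le> y"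
  shows "\<bar>\<phi> i y\<bar> \<le> R * f0 y"
proof -
  have "\<bar>\<phi> i y\<bar> \<le> (\<Sum>k\<in>{1..M}. \<bar>direction i k * poisson (a * real k) y\<bar>)"
    unfolding \<phi>_def grid_mixture_pos_arg[OF assms(2)] by (rule sum_abs)
  also have "\<dots> \<le> (\<Sum>k\<in>{1..M}. (R * p) * poisson (a * real k) y)"
    using abs_direction_le[OF assms(1)] a
    by (intro sum_mono) (auto simp: abs_mult poisson_nonneg intro!: mult_right_mono)
  also have "\<dots> = R * f0 y"
    unfolding f0_def grid_mixture_pos_arg[OF assms(2)]
    by (simp add: base_def sum_distrib_left mult_ac)
  finally show ?thesis .
qed

text \<open>For \<open>y \<ge> M\<close> the factor \<open>a ^ y \<le> a ^ M\<close> is split off; what remains is the exponential series at \<open>M\<close>.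
  The power \<open>a ^ M\<close> is what beats the factor \<open>(1 / a) ^ (2 m)\<close> hidden in \<open>R\<^sup>2\<close>.\<close>
lemma f0_tail:
  assumes "M \<le> y"
  shows "f0 y \<le> p * real M * a ^ M * (real M ^ y / fact y)"
proof -
  have y: "1 \<le> y" using assms M by simp
  have "f0 y = (\<Sum>k\<in>{1..M}. p * poisson (a * real k) y)"
    unfolding f0_def grid_mixture_pos_arg[OF y] by (simp add: base_def)
  also have "\<dots> \<le> (\<Sum>k\<in>{1..M}. p * (a ^ M * (real M ^ y / fact y)))"
  proof (intro sum_mono mult_left_mono)
    fix k assume k: "k \<in> {1..M}"
    have "(a * real k) ^ y \<le> (a * real M) ^ y"
      using k a by (intro power_mono mult_left_mono) auto
    also have "\<dots> = a ^ y * real M ^ y" by (rule power_mult_distrib)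
    also have "\<dots> \<le> a ^ M * real M ^ y"
      using a assms by (intro mult_right_mono power_decreasing) auto
    finally have le: "(a * real k) ^ y \<le> a ^ M * real M ^ y" .
    have "poisson (a * real k) y \<le> 1 * ((a * real k) ^ y / fact y)"
      unfolding poisson_def using a by (intro mult_right_mono) auto
    also have "\<dots> \<le> a ^ M * (real M ^ y / fact y)"
      using le by (simp add: divide_right_mono)
    finally show "poisson (a * real k) y \<le> a ^ M * (real M ^ y / fact y)" .
  qed (use p in auto)
  finally show ?thesis by (simp add: mult_ac)
qed

lemma tail_term_sums:
  "(\<lambda>y. p * real M * a ^ M * (real M ^ y / fact y)) sums (p * real M * a ^ M * exp (real M))"
  by (intro sums_mult power_div_fact_sums)

lemma tail_term_nonneg: "0 \<le> p * real M * a ^ M * (real M ^ y / fact y)"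
  using p a by simp

text \<open>The values of \<open>\<phi> i\<close> sum to zero, so the value at \<open>0\<close> balances the \<open>1\<close> at \<open>i\<close> and the tail.\<close>
lemma abs_\<phi>_0_le:
  assumes "1 \<le> i" "i \<le> m"
  shows "\<bar>\<phi> i 0\<bar> \<le> 2"
proof -
  define T where "T y = R * (p * real M * a ^ M * (real M ^ y / fact y))" for y
  \<comment> \<open>the part of \<open>\<phi> i\<close> beyond \<open>M\<close>\<close>
  define D where "D y = \<phi> i y - (if y = 0 then \<phi> i 0 else 0) - (if y = i then 1 else 0)" for y
  have "\<phi> i sums 0"
    using grid_mixture_sums[of a M "direction i"] by (simp add: \<phi>_def sum_direction)
  then have D: "D sums (0 - \<phi> i 0 - 1)"
    unfolding D_def by (intro sums_diff) (use sums_single[of 0 "\<lambda>_. \<phi> i 0"] sums_single[of i "\<lambda>_. 1"] in auto)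
  have T: "T sums (R * (p * real M * a ^ M * exp (real M)))"
    unfolding T_def by (intro sums_mult tail_term_sums)
  have le: "\<bar>D y\<bar> \<le> T y" for y
  proof (cases "y \<le> M")
    case True
    then have "D y = 0" using assms \<phi>_eq[of y i] by (auto simp: D_def)
    moreover have "0 \<le> T y"
      unfolding T_def by (rule mult_nonneg_nonneg[OF _ tail_term_nonneg]) (use R in simp)
    ultimately show ?thesis by simp
  next
    case False
    then have "\<bar>D y\<bar> = \<bar>\<phi> i y\<bar>" using assms m by (auto simp: D_def)
    also have "\<dots> \<le> R * f0 y" using False assms by (intro abs_\<phi>_le) auto
    also have "\<dots> \<le> T y" unfolding T_def using False R by (intro mult_left_mono f0_tail) auto
    finally show ?thesis .
  qed
  have "R * (p * real M * a ^ M * exp (real M)) \<le> R * R * (p * real M * a ^ M * exp (real M))"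
    using R p a by (intro mult_right_mono) auto
  also have "\<dots> \<le> 1" using tail by (simp add: power2_eq_square)
  finally have bound: "R * (p * real M * a ^ M * exp (real M)) \<le> 1" .
  have "0 - \<phi> i 0 - 1 \<le> R * (p * real M * a ^ M * exp (real M))"
    by (rule sums_le[OF _ D T]) (use le in \<open>auto simp: abs_le_iff\<close>)
  moreover have "- (R * (p * real M * a ^ M * exp (real M))) \<le> 0 - \<phi> i 0 - 1"
    by (rule sums_le[OF _ sums_minus[OF T] D]) (use le in \<open>auto simp: abs_le_iff minus_le_iff\<close>)
  ultimately show ?thesis using bound by linarith
qed

lemma \<tau>_nonneg: "0 \<le> \<tau> i"
  using less_imp_le[OF f0_pos] by (simp add: \<tau>_def)

lemma \<tau>_sq: "(\<tau> i)\<^sup>2 = f0 i / (20 * real n)"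
  using less_imp_le[OF f0_pos] by (simp add: \<tau>_def)

lemma \<tau>_le: "\<tau> i \<le> 1 / sqrt (real n)"
proof -
  have "f0 i / (20 * real n) \<le> 1 / real n"
    using f0_le_1[of i] n by (simp add: field_simps)
  then have "\<tau> i \<le> sqrt (1 / real n)" unfolding \<tau>_def by (rule real_sqrt_le_mono)
  then show ?thesis by (simp add: real_sqrt_divide)
qed

text \<open>At most \<open>m\<close> directions are added, each with a step of at most \<open>1 / sqrt n\<close>. At a positive node a
  direction is at most \<open>R\<close> times the base mass, so \<open>R_le\<close> suffices. At \<open>0\<close> it can be as large as
  \<open>M R p\<close>, but there the base mass is at least \<open>M p\<close>.\<close>
lemma weights_close_to_base:
  assumes U: "U \<subseteq> {1..m}" and k: "k \<le> M"
  shows "\<bar>weights U k - base k\<bar> \<le> base k / 2"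
proof -
  define b where "b = (if k = 0 then real M * (R * p) else R * p)"
  have b: "\<bar>direction i k\<bar> \<le> b" if i: "i \<in> U" for i
  proof (cases "k = 0")
    case True
    have "\<bar>direction i 0\<bar> = \<bar>\<Sum>l\<in>{1..M}. direction i l\<bar>"
      by (simp add: direction_def)
    also have "\<dots> \<le> (\<Sum>l\<in>{1..M}. R * p)"
      by (rule order.trans[OF sum_abs], intro sum_mono abs_direction_le) (use i U in auto)
    finally show ?thesis using True by (simp add: b_def)
  next
    case False
    then show ?thesis using abs_direction_le[of i k] i U k by (auto simp: b_def)
  qed
  have b0: "0 \<le> b" using R p by (simp add: b_def)
  have "\<bar>weights U k - base k\<bar> \<le> (\<Sum>i\<in>U. \<bar>\<tau> i * direction i k\<bar>)"
    by (simp add: weights_def sum_abs)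
  also have "\<dots> \<le> (\<Sum>i\<in>U. 1 / sqrt (real n) * b)"
    using b \<tau>_le \<tau>_nonneg by (intro sum_mono) (auto simp: abs_mult intro!: mult_mono[of _ "1 / sqrt (real n)", simplified])
  also have "\<dots> = real (card U) * (b / sqrt (real n))" by simp
  also have "\<dots> \<le> real m * (b / sqrt (real n))"
    using card_mono[OF _ U] b0 by (intro mult_right_mono) auto
  also have "\<dots> \<le> b / R / 2"
    using R_le n R mult_right_mono[OF R_le b0] by (simp add: field_simps)
  also have "\<dots> \<le> base k / 2"
  proof -
    have "b / R = (if k = 0 then real M * p else p)" using R(1) by (simp add: b_def)
    then show ?thesis using p(2) by (simp add: base_def mult.commute)
  qed
  finally show ?thesis .
qed

lemma weights_nonneg: "U \<subseteq> {1..m} \<Longrightarrow> k \<le> M \<Longrightarrow> 0 \<le> weights U k"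
  using weights_close_to_base[of U k] base_pos[of k] by linarith

lemma sum_weights: "(\<Sum>k\<le>M. weights U k) = 1"
proof -
  have "(\<Sum>k\<le>M. \<Sum>i\<in>U. \<tau> i * direction i k) = (\<Sum>i\<in>U. \<tau> i * (\<Sum>k\<le>M. direction i k))"
    by (subst sum.swap) (simp add: sum_distrib_left)
  then show ?thesis by (simp add: weights_def sum.distrib sum_base sum_direction)
qed

lemma sum_pos_weights_le:
  assumes "U \<subseteq> {1..m}"
  shows "(\<Sum>k\<in>{1..M}. weights U k) \<le> 3 / 2 * (real M * p)"
proof -
  have "(\<Sum>k\<in>{1..M}. weights U k) \<le> (\<Sum>k\<in>{1..M}. 3 / 2 * p)"
  proof (intro sum_mono)
    fix k assume "k \<in> {1..M}"
    then show "weights U k \<le> 3 / 2 * p"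
      using weights_close_to_base[OF assms, of k] unfolding abs_le_iff by (auto simp: base_def)
  qed
  then show ?thesis by simp
qed

lemma mixture_between:
  assumes "U \<subseteq> {1..m}"
  shows "f0 y / 2 \<le> grid_mixture a M (weights U) y"
    and "grid_mixture a M (weights U) y \<le> 3 / 2 * f0 y"
proof -
  have w: "base k / 2 \<le> weights U k" "weights U k \<le> 3 / 2 * base k" if "k \<le> M" for k
    using weights_close_to_base[OF assms that] unfolding abs_le_iff by linarith+
  have "f0 y / 2 = (\<Sum>k\<le>M. base k / 2 * poisson (a * real k) y)"
    by (simp add: f0_def grid_mixture_def sum_divide_distrib)
  also have "\<dots> \<le> grid_mixture a M (weights U) y"
    unfolding grid_mixture_def using w a by (intro sum_mono mult_right_mono poisson_nonneg) auto
  finally show "f0 y / 2 \<le> grid_mixture a M (weights U) y" .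
  have "grid_mixture a M (weights U) y \<le> (\<Sum>k\<le>M. 3 / 2 * base k * poisson (a * real k) y)"
    unfolding grid_mixture_def using w a by (intro sum_mono mult_right_mono poisson_nonneg) auto
  also have "\<dots> = 3 / 2 * f0 y"
    by (simp add: f0_def grid_mixture_def sum_distrib_left mult_ac)
  finally show "grid_mixture a M (weights U) y \<le> 3 / 2 * f0 y" .
qed

lemma mixture_insert:
  assumes "U \<subseteq> {1..m}" "i \<notin> U"
  shows "grid_mixture a M (weights U) y - grid_mixture a M (weights (insert i U)) y = - \<tau> i * \<phi> i y"
proof -
  have "finite U" using assms(1) finite_subset by blast
  then have "weights (insert i U) k = weights U k + \<tau> i * direction i k" for k
    using assms by (simp add: weights_def)
  then show ?thesis
    by (simp add: grid_mixture_def \<phi>_def distrib_right sum.distrib sum_distrib_left mult.assoc sum_negf)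
qed

text \<open>The chi-square distance of neighbours has three sources: the point \<open>i\<close>, where the step size makes
  it \<open>1 / (20 n)\<close>; the point \<open>0\<close>, where \<open>f0\<close> is at least \<open>1 / 2\<close>; and the negligible values beyond \<open>M\<close>.\<close>
lemma neighbours_close:
  assumes i: "i \<in> {1..m}" and U: "U \<subseteq> {1..m} - {i}"
  shows "\<exists>H \<le> 1 / (2 * real n). (\<lambda>y. (sqrt (grid_mixture a M (weights U) y)
    - sqrt (grid_mixture a M (weights (insert i U)) y))\<^sup>2) sums H"
proof -
  define h where "h y = (sqrt (grid_mixture a M (weights U) y)
    - sqrt (grid_mixture a M (weights (insert i U)) y))\<^sup>2" for y
  define g where "g y = (\<tau> i)\<^sup>2 * ((if y = 0 then 8 else 0) + (if y = i then 1 / f0 i else 0)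
    + R\<^sup>2 * (p * real M * a ^ M * (real M ^ y / fact y)))" for y
  let ?S = "(\<tau> i)\<^sup>2 * (8 + 1 / f0 i + R\<^sup>2 * (p * real M * a ^ M * exp (real M)))"
  have g: "g sums ?S"
    unfolding g_def
    by (intro sums_mult sums_add tail_term_sums)
      (use sums_single[of 0 "\<lambda>_. 8"] sums_single[of i "\<lambda>_. 1 / f0 i"] in auto)
  have U': "U \<subseteq> {1..m}" "insert i U \<subseteq> {1..m}" "i \<notin> U" using i U by auto
  have "h y \<le> (\<tau> i)\<^sup>2 * ((\<phi> i y)\<^sup>2 / f0 y)" for y
    using sq_diff_sqrt_le[OF f0_pos mixture_between(1)[OF U'(1)] mixture_between(1)[OF U'(2)], of y]
    unfolding mixture_insert[OF U'(1,3)] h_def by (simp add: power_mult_distrib)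
  moreover have "(\<phi> i y)\<^sup>2 / f0 y \<le> (if y = 0 then 8 else 0) + (if y = i then 1 / f0 i else 0)
    + R\<^sup>2 * (p * real M * a ^ M * (real M ^ y / fact y))" for y
  proof -
    have t: "0 \<le> R\<^sup>2 * (p * real M * a ^ M * (real M ^ y / fact y))"
      by (rule mult_nonneg_nonneg[OF _ tail_term_nonneg]) simp
    consider "y = 0" | "1 \<le> y" "y \<le> M" | "M < y" by linarith
    then show ?thesis
    proof cases
      case 1
      have "\<bar>\<phi> i 0\<bar>\<^sup>2 \<le> 2\<^sup>2" using i by (intro power_mono abs_\<phi>_0_le) auto
      then have "(\<phi> i 0)\<^sup>2 \<le> 8 * f0 0" using f0_0_ge by simp
      then have "(\<phi> i 0)\<^sup>2 / f0 0 \<le> 8" using f0_pos[of 0] by (simp add: field_simps)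
      with 1 t i show ?thesis by simp
    next
      case 2
      then show ?thesis using t by (auto simp: \<phi>_eq)
    next
      case 3
      have "\<bar>\<phi> i y\<bar>\<^sup>2 \<le> (R * f0 y)\<^sup>2" using i 3 by (intro power_mono abs_\<phi>_le) auto
      then have "(\<phi> i y)\<^sup>2 / f0 y \<le> R\<^sup>2 * f0 y"
        using f0_pos[of y] by (simp add: field_simps power2_eq_square)
      also have "\<dots> \<le> R\<^sup>2 * (p * real M * a ^ M * (real M ^ y / fact y))"
        using 3 by (intro mult_left_mono f0_tail) auto
      finally show ?thesis using 3 i m by simp
    qed
  qed
  ultimately have hg: "h y \<le> g y" for y
    unfolding g_def by (meson mult_left_mono order.trans zero_le_power2)
  have "summable h"
    by (rule summable_comparison_test'[OF sums_summable[OF g], of 0]) (use hg in \<open>simp add: h_def\<close>)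
  then have h: "h sums suminf h" by (rule summable_sums)
  have "suminf h \<le> ?S" by (rule sums_le[OF hg h g])
  also have "\<dots> \<le> (\<tau> i)\<^sup>2 * (8 + 1 / f0 i + 1)"
    using tail by (intro mult_left_mono) auto
  also have "\<dots> = (9 * f0 i + 1) / (20 * real n)"
    using f0_pos[of i] n by (simp add: \<tau>_sq field_simps)
  also have "\<dots> \<le> 10 / (20 * real n)"
    using f0_le_1[of i] by (intro divide_right_mono) auto
  finally show ?thesis using h by (auto simp: h_def[abs_def])
qed

lemma neighbours_separated:
  assumes i: "i \<in> {1..m}" and U: "U \<subseteq> {1..m} - {i}"
  shows "1 / (120 * real n) \<le> (sqrt (grid_mixture a M (weights U) i)
    - sqrt (grid_mixture a M (weights (insert i U)) i))\<^sup>2"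
proof -
  have U': "U \<subseteq> {1..m}" "insert i U \<subseteq> {1..m}" "i \<notin> U" using i U by auto
  have nn: "0 \<le> grid_mixture a M (weights V) i" if "V \<subseteq> {1..m}" for V
    using mixture_between(1)[OF that, of i] f0_pos[of i] by linarith
  have "\<phi> i i = 1" using i m by (simp add: \<phi>_eq)
  then have "(grid_mixture a M (weights U) i - grid_mixture a M (weights (insert i U)) i)\<^sup>2 = f0 i / (20 * real n)"
    unfolding mixture_insert[OF U'(1,3)] by (simp add: \<tau>_sq)
  then show ?thesis
    using sq_diff_sqrt_ge[OF f0_pos nn[OF U'(1)] mixture_between(2)[OF U'(1)] nn[OF U'(2)] mixture_between(2)[OF U'(2)]]
      f0_pos[of i] by (simp add: field_simps)
qed

lemma minimax_risk_ge:
  assumes \<G>: "\<And>w. (\<And>k. k \<le> M \<Longrightarrow> 0 \<le> w k) \<Longrightarrow> (\<Sum>k\<le>M. w k) = 1 \<Longrightarrow>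
      (\<Sum>k\<in>{1..M}. w k) \<le> 3 / 2 * (real M * p) \<Longrightarrow> grid_prior a M w \<in> \<G>"
  shows "ennreal (real m / (1920 * real n)) \<le> minimax_risk n \<G>"
proof -
  have "ennreal (real (card {1..m}) * (1 / (120 * real n)) / 16) \<le> minimax_risk n \<G>"
  proof (rule assouad[where G = "\<lambda>U. grid_prior a M (weights U)"
        and f = "\<lambda>U. grid_mixture a M (weights U)"])
    fix U assume U: "U \<subseteq> {1..m}"
    show "grid_prior a M (weights U) \<in> \<G>"
      by (intro \<G> weights_nonneg[OF U] sum_weights sum_pos_weights_le[OF U])
    show "poisson_mixture (grid_prior a M (weights U)) = grid_mixture a M (weights U)"
      by (rule poisson_mixture_grid_prior[OF weights_nonneg[OF U] sum_weights])
    show "grid_mixture a M (weights U) sums 1"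
      using grid_mixture_sums[of a M "weights U"] by (simp only: sum_weights)
    show "0 \<le> grid_mixture a M (weights U) y" for y
      using mixture_between(1)[OF U, of y] f0_pos[of y] by linarith
  qed (use n neighbours_close neighbours_separated in auto)
  then show ?thesis by simp
qed

end

section \<open>Choice of the grid\<close>

text \<open>Four times as many nodes as coordinates are used. The mass of each positive node is chosen so
  small that the priors on the grid remain subexponential with parameter \<open>s\<close> when they are perturbed.
  All factors other than powers of \<open>a\<close> are exponential in \<open>M\<close> (recall \<open>a \<le> s\<close>). The condition for positivity then becomes
  \<open>large\<close>. In the tail condition the powers of \<open>a\<close> combine to \<open>a ^ (M - 2 m) = a ^ (2 m)\<close>, which beats
  the exponential factors once \<open>a\<close> is below an absolute constant.\<close>
lemma minimax_risk_ge_grid: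
  fixes a s :: real and m n :: nat
  assumes a: "0 < a" "a \<le> exp (- 24)" "a \<le> s" and m: "1 \<le> m" and n: "0 < n"
    and large: "(exp 28 / a) ^ m \<le> sqrt (real n)"
    and sub: "compact_priors (4 * a * real m) \<inter> SubE s \<subseteq> \<G>"
  shows "ennreal (real m / (1920 * real n)) \<le> minimax_risk n \<G>"
proof -
  define M where "M = 4 * m"
  define x where "x = real M"
  define p where "p = exp (- (a * x) / s) / (2 * x)"
  define Q where "Q = (1 / a) ^ m * (4 * exp 1) ^ M"
  define R where "R = exp (a * x) * Q / p"
  have x: "4 \<le> x" using m by (simp add: x_def M_def)
  have s: "0 < s" using a by simp
  have a1: "a \<le> 1" using a(2) by (rule order.trans) simp
  have p: "0 < p" using x by (simp add: p_def)
  have e2: "2 \<le> exp (1 :: real)" using exp_ge_add_one_self[of 1] by simp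
  have pow: "exp c ^ M = exp (c * x)" for c :: real
    by (simp add: x_def exp_of_nat_mult[symmetric] mult.commute)
  have four: "(4 * exp 1) ^ M \<le> exp (3 * x)"
  proof -
    have "4 * exp (1 :: real) \<le> exp 1 * exp 1 * exp 1"
      using mult_mono[OF e2 e2] by (intro mult_right_mono) auto
    also have "\<dots> = exp 3" by (simp add: exp_add[symmetric])
    finally have "(4 * exp (1 :: real)) ^ M \<le> exp 3 ^ M" by (intro power_mono) auto
    then show ?thesis by (simp only: pow)
  qed
  have sq: "2 * x\<^sup>2 \<le> exp (2 * x)"
    using exp_lower_Taylor_quadratic[of "2 * x"] x by (simp add: power2_eq_square)
  have ax: "a * x \<le> x" "a * x / s \<le> x"
    using a a1 s x mult_right_mono[of a 1 x] mult_right_mono[of "a / s" 1 x] by (auto simp: field_simps)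
  have Q: "1 \<le> Q"
    unfolding Q_def using a a1 e2
    by (intro mult_ge1_I one_le_power) auto
  have Q_le: "Q \<le> (1 / a) ^ m * exp (3 * x)"
    unfolding Q_def using four a by (intro mult_left_mono) auto
  have R_eq: "R = 2 * x * (exp (a * x) * exp (a * x / s)) * Q"
    using x by (simp add: R_def p_def exp_minus field_simps)
  \<comment> \<open>all exponential factors together are at most \<open>exp (7 x) = exp 28 ^ m\<close>\<close>
  have "2 * real m * R = x\<^sup>2 * (exp (a * x) * exp (a * x / s)) * Q"
    by (simp add: R_eq x_def M_def power2_eq_square)
  also have "\<dots> \<le> exp (2 * x) * (exp x * exp x) * ((1 / a) ^ m * exp (3 * x))"
    using sq Q Q_le ax x zero_le_power2[of x] by (intro mult_mono) (linarith | simp)+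
  also have "\<dots> = (1 / a) ^ m * exp (7 * x)"
    by (simp add: exp_add[symmetric])
  also have "\<dots> = (exp 28 / a) ^ m"
    by (simp add: power_divide x_def M_def exp_of_nat_mult[symmetric] mult.commute)
  also note large
  finally have R_le: "2 * real m * R \<le> sqrt (real n)" .
  have R1: "1 \<le> R"
  proof -
    have "1 \<le> exp (a * x)" "1 \<le> exp (a * x / s)" using a s x by auto
    then show ?thesis unfolding R_eq using Q x by (intro mult_ge1_I) auto
  qed
  have Rp: "R * p = exp (a * x) * Q" using p by (simp add: R_def)
  \<comment> \<open>all exponential factors together are at most \<open>exp (12 x) = exp 24 ^ (2 m)\<close>\<close>
  have "R\<^sup>2 * (p * x * a ^ M * exp x) = R * (R * p) * x * a ^ M * exp x"
    by (simp add: power2_eq_square)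
  also have "\<dots> = 2 * x\<^sup>2 * (exp (a * x) * exp (a * x / s) * exp (a * x)) * (Q * Q) * (a ^ M * exp x)"
    unfolding Rp unfolding R_eq by (simp add: power2_eq_square mult_ac)
  also have "\<dots> \<le> exp (2 * x) * (exp x * exp x * exp x) *
      (((1 / a) ^ m * exp (3 * x)) * ((1 / a) ^ m * exp (3 * x))) * (a ^ M * exp x)"
    using sq Q Q_le ax x a by (intro mult_mono mult_right_mono) auto
  also have "\<dots> = ((1 / a) ^ m * (1 / a) ^ m * a ^ M) * exp (12 * x)"
    by (simp add: exp_add[symmetric] mult_ac)
  also have "(1 / a) ^ m * (1 / a) ^ m * a ^ M = (a ^ 2) ^ m"
  proof -
    have "(1 / a) ^ m * (1 / a) ^ m * a ^ M = (1 / a * (1 / a) * a ^ 4) ^ m"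
      by (simp only: M_def power_mult power_mult_distrib)
    also have "1 / a * (1 / a) * a ^ 4 = a ^ 2"
      using a by (simp add: power2_eq_square power4_eq_xxxx)
    finally show ?thesis .
  qed
  also have "(a ^ 2) ^ m \<le> (exp (- 24) ^ 2) ^ m"
    using a by (intro power_mono) auto
  also have "(exp (- 24) ^ 2) ^ m * exp (12 * x) = (1 :: real)"
    by (simp add: x_def M_def exp_of_nat_mult[symmetric] exp_add[symmetric] power_mult[symmetric])
  finally have tail: "R\<^sup>2 * (p * x * a ^ M * exp x) \<le> 1" by simp
  have xp: "x * p = exp (- (a * x) / s) / 2" using x by (simp add: p_def)
  have "exp (- (a * x) / s) \<le> 1" using a s x by simp
  interpret perturbed_grid a p R m M n
  proof
    show "m \<le> M" "1 \<le> M" using m by (auto simp: M_def)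
    show "real M * p \<le> 1 / 2" using xp \<open>exp (- (a * x) / s) \<le> 1\<close> by (simp add: x_def)
    show "exp (a * real M) * ((1 / a) ^ m * (4 * exp 1) ^ M) \<le> R * p"
      using p by (simp add: R_def Q_def x_def)
    show "R\<^sup>2 * (p * real M * a ^ M * exp (real M)) \<le> 1" using tail by (simp add: x_def)
  qed (use a a1 n p R1 R_le in auto)
  show ?thesis
  proof (rule minimax_risk_ge)
    fix w :: "nat \<Rightarrow> real"
    assume w: "\<And>k. k \<le> M \<Longrightarrow> 0 \<le> w k" "(\<Sum>k\<le>M. w k) = 1"
      and le: "(\<Sum>k\<in>{1..M}. w k) \<le> 3 / 2 * (real M * p)"
    have "real M * p = exp (- (a * real M) / s) / 2" using xp by (simp add: x_def)
    then have "(\<Sum>k\<in>{1..M}. w k) \<le> 2 * exp (- (a * real M) / s)"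
      using le exp_gt_zero[of "- (a * real M) / s"] by linarith
    then have "grid_prior a M w \<in> SubE s"
      using w a s by (intro grid_prior_in_SubE) auto
    moreover have "grid_prior a M w \<in> compact_priors (4 * a * real m)"
      using w a by (intro grid_prior_in_compact_priors) (auto simp: M_def)
    ultimately show "grid_prior a M w \<in> \<G>" using sub by blast
  qed
qed

lemma power_le_sqrtI:
  fixes b :: real
  assumes "0 < b" "0 < n" "real m * ln b \<le> ln (real n) / 2"
  shows "b ^ m \<le> sqrt (real n)"
proof -
  have "b ^ m = exp (real m * ln b)" using assms(1) by (simp add: exp_of_nat_mult)
  also have "\<dots> \<le> exp (ln (real n) / 2)" using assms(3) by simp
  also have "\<dots> = sqrt (real n)"
    using assms(2) by (intro real_sqrt_unique[symmetric]) (simp_all add: power2_eq_square exp_add[symmetric])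
  finally show ?thesis .
qed

lemma half_le_nat_floor:
  fixes t :: real
  assumes "1 \<le> t"
  shows "t / 2 \<le> real (nat \<lfloor>t\<rfloor>)" "real (nat \<lfloor>t\<rfloor>) \<le> t" "1 \<le> nat \<lfloor>t\<rfloor>"
proof -
  have "1 \<le> \<lfloor>t\<rfloor>" using assms by (simp add: le_floor_iff)
  then have eq: "real (nat \<lfloor>t\<rfloor>) = of_int \<lfloor>t\<rfloor>" and ge: "1 \<le> real_of_int \<lfloor>t\<rfloor>"
    by simp_all
  show "1 \<le> nat \<lfloor>t\<rfloor>" using \<open>1 \<le> \<lfloor>t\<rfloor>\<close> by linarith
  show "real (nat \<lfloor>t\<rfloor>) \<le> t" unfolding eq by simp
  show "t / 2 \<le> real (nat \<lfloor>t\<rfloor>)"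
    unfolding eq using ge real_of_int_floor_add_one_gt[of t] by linarith
qed

text \<open>The grid has to fit into \<open>[0, h]\<close>, so \<open>a = h / (4 m)\<close> shrinks and \<open>large\<close> requires \<open>m ln m\<close> to be
  at most of order \<open>ln n\<close>.\<close>
lemma minimax_risk_compact:
  fixes h :: real
  assumes h: "0 < h"
  shows "\<forall>\<^sub>F n in sequentially. ennreal (1 / 15360 / real n * (ln (real n) / ln (ln (real n))))
    \<le> minimax_risk n (compact_priors h)"
proof -
  define t where "t n = ln (real n) / ln (ln (real n)) / 4" for n :: nat
  \<comment> \<open>the bound by \<open>h exp 24\<close> makes the spacing \<open>h / (4 m)\<close> at most \<open>exp (- 24)\<close>\<close>
  have ev1: "\<forall>\<^sub>F n :: nat in sequentially. max 1 (h * exp 24) \<le> t n"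
    unfolding t_def by real_asymp
  \<comment> \<open>with this, \<open>ln (exp 28 / a) \<le> 2 ln (ln n)\<close>\<close>
  have ev2: "\<forall>\<^sub>F n :: nat in sequentially. \<bar>28 + ln (4 / h)\<bar> \<le> ln (ln (real n))"
    by real_asymp
  have ev3: "\<forall>\<^sub>F n :: nat in sequentially. 1 \<le> ln (ln (real n))"
    by real_asymp
  have ev4: "\<forall>\<^sub>F n :: nat in sequentially. 0 < ln (real n)"
    by real_asymp
  show ?thesis
    using ev1 ev2 ev3 ev4 eventually_gt_at_top[of 0]
  proof eventually_elim
    case (elim n)
    define L where "L = ln (real n)"
    define m where "m = nat \<lfloor>t n\<rfloor>"
    have t: "1 \<le> t n" "h * exp 24 \<le> t n" using elim by auto
    note m = half_le_nat_floor[OF t(1), folded m_def]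
    have LL: "1 \<le> ln L" "\<bar>28 + ln (4 / h)\<bar> \<le> ln L" using elim by (auto simp: L_def)
    have L: "0 < L" using elim by (simp add: L_def)
    have tL: "t n = L / ln L / 4" by (simp add: t_def L_def)
    have "t n \<le> L"
    proof -
      have "L / ln L \<le> L / 1" by (rule divide_left_mono) (use L LL(1) in linarith)+
      then show ?thesis using L by (simp add: tL)
    qed
    have m0: "0 < real m" using m(3) by simp
    define a where "a = h / (4 * real m)"
    have a: "0 < a" using h m0 by (simp add: a_def)
    have "exp 24 * h \<le> 4 * real m" using t m(1) by (simp add: mult.commute)
    then have "a \<le> exp (- 24)"
      using m0 by (simp add: a_def exp_minus field_simps)
    then have a1: "a \<le> exp (- 24)" "a \<le> 1"
      by (simp, rule order.trans) simp
    have "exp 28 / a = exp 28 * ((4 / h) * real m)" by (simp add: a_def)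
    then have "ln (exp 28 / a) = 28 + ln (4 / h) + ln (real m)"
      using h m0 by (simp add: ln_mult ln_div)
    also have "ln (real m) \<le> ln L"
      using m0 m(2) \<open>t n \<le> L\<close> by (intro ln_mono) auto
    finally have "ln (exp 28 / a) \<le> 2 * ln L" using LL(2) by linarith
    then have "real m * ln (exp 28 / a) \<le> t n * (2 * ln L)"
      using m(2) LL t by (smt (verit) mult_left_mono mult_right_mono m0)
    also have "\<dots> = L / 2" using LL by (simp add: tL)
    finally have "(exp 28 / a) ^ m \<le> sqrt (real n)"
      using a elim by (intro power_le_sqrtI) (auto simp: L_def)
    moreover have "4 * a * real m = h" using m0 by (simp add: a_def)
    ultimately have "ennreal (real m / (1920 * real n)) \<le> minimax_risk n (compact_priors h)"
      using a a1 m(3) elim(5) by (intro minimax_risk_ge_grid[of a 1]) auto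
    moreover have "1 / 15360 / real n * (ln (real n) / ln (ln (real n))) \<le> real m / (1920 * real n)"
      using m(1) elim(5) by (simp add: t_def divide_simps)
    ultimately show ?case by (meson ennreal_leI order.trans)
  qed
qed

text \<open>The support is unrestricted, so \<open>a\<close> is a constant and \<open>large\<close> only requires \<open>m\<close> to be at most a
  constant multiple of \<open>ln n\<close>.\<close>
lemma minimax_risk_SubE:
  fixes s :: real
  assumes s: "0 < s"
  shows "\<exists>c>0. \<forall>\<^sub>F n in sequentially. ennreal (c / real n * ln (real n)) \<le> minimax_risk n (SubE s)"
proof -
  define a where "a = min (exp (- 24)) s"
  define c where "c = 1 / (2 * ln (exp 28 / a))"
  have a: "0 < a" "a \<le> exp (- 24)" "a \<le> s" using s by (auto simp: a_def)
  have "1 < exp 28 / a"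
  proof -
    have "a \<le> 1" using a(2) by (rule order.trans) simp
    also have "1 < exp (28 :: real)" by simp
    finally show ?thesis using a by simp
  qed
  then have ln_pos: "0 < ln (exp 28 / a)" by simp
  then have c: "0 < c" by (simp add: c_def)
  have "\<forall>\<^sub>F n :: nat in sequentially. 1 \<le> c * ln (real n)"
    using c by real_asymp
  then have "\<forall>\<^sub>F n in sequentially. ennreal (c / 3840 / real n * ln (real n)) \<le> minimax_risk n (SubE s)"
    using eventually_gt_at_top[of 0]
  proof eventually_elim
    case (elim n)
    define m where "m = nat \<lfloor>c * ln (real n)\<rfloor>"
    note m = half_le_nat_floor[OF elim(1), folded m_def]
    have "real m * ln (exp 28 / a) \<le> c * ln (real n) * ln (exp 28 / a)"
      using m(2) ln_pos by (intro mult_right_mono) auto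
    also have "\<dots> = ln (real n) / 2" using ln_pos by (simp add: c_def)
    finally have "(exp 28 / a) ^ m \<le> sqrt (real n)"
      using a elim by (intro power_le_sqrtI) auto
    then have "ennreal (real m / (1920 * real n)) \<le> minimax_risk n (SubE s)"
      using a m(3) elim(2) by (intro minimax_risk_ge_grid[of a s]) auto
    moreover have "c / 3840 / real n * ln (real n) \<le> real m / (1920 * real n)"
      using m(1) elim(2) by (simp add: field_simps)
    ultimately show ?case by (meson ennreal_leI order.trans)
  qed
  then show ?thesis using c by (intro exI[of _ "c / 3840"]) auto
qed

theorem theorem21:
  shows "(\<forall>h::real. h > 0 \<longrightarrow>
            (\<exists>c\<^sub>0::real. c\<^sub>0 > 0 \<and> (\<exists>n\<^sub>0::nat. \<forall>n\<ge>n\<^sub>0.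
               minimax_risk n (compact_priors h)
                 \<ge> ennreal (c\<^sub>0 / real n * (ln (real n) / ln (ln (real n))))))) \<and>
         (\<forall>s::real. s > 0 \<longrightarrow>
            (\<exists>c\<^sub>1::real. c\<^sub>1 > 0 \<and> (\<exists>n\<^sub>0::nat. \<forall>n\<ge>n\<^sub>0.
               minimax_risk n (SubE s) \<ge> ennreal (c\<^sub>1 / real n * ln (real n)))))"
proof (intro conjI allI impI)
  fix h :: real
  assume "h > 0"
  then show "\<exists>c\<^sub>0>0. \<exists>n\<^sub>0. \<forall>n\<ge>n\<^sub>0. ennreal (c\<^sub>0 / real n * (ln (real n) / ln (ln (real n))))
      \<le> minimax_risk n (compact_priors h)"
    using minimax_risk_compact[of h]
    by (intro exI[of _ "1 / 15360"]) (simp only: eventually_sequentially, simp)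
next
  fix s :: real
  assume "s > 0"
  then show "\<exists>c\<^sub>1>0. \<exists>n\<^sub>0. \<forall>n\<ge>n\<^sub>0. ennreal (c\<^sub>1 / real n * ln (real n)) \<le> minimax_risk n (SubE s)"
    using minimax_risk_SubE[of s] by (simp only: eventually_sequentially)
qed

end
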